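(* Let $n\ge 2$, $c\in\mathbb{Z}_+^n$, and let $K=K(c)$ be the $A_n$-crystal with parameter $c$. Let $a\in\mathcal{B}(c)$, let $K^{\uparrow}[a]$ be the upper subcrystal of $K$ containing the principal vertex $\pi[a]$, let $h^{\uparrow}\in\mathbb{Z}^{n-1}$ be the coordinate of $\pi[a]$ in the principal lattice $\Pi^{\uparrow}[a]$ of $K^{\uparrow}[a]$, and let $\Delta=(\Delta_1,\ldots,\Delta_{n-1})$ be such that $p:=h^{\uparrow}+\Delta$ is a coordinate of a vertex $v$ of $\Pi^{\uparrow}[a]$ (so $\Delta$ is the deviation of $v$ from $\pi[a]$ in $\Pi^{\uparrow}[a]$). Let $\tilde K$ be the middle subcrystal of $K$ containing $v$, let $K^{\downarrow}[b]$ ($b\in\mathcal{B}(c)$) be the lower subcrystal of $K$ containing $\tilde K$, and let $\nabla=(\nabla_2,\ldots,\nabla_n)$ be the deviation, from the heart $\pi[b]$, of the unique vertex of $\tilde K$ lying in the principal lattice $\Pi^{\downarrow}[b]$ of $K^{\downarrow}[b]$. Then $$\nabla_i=-\Delta_{i-1},\qquad i=2,\ldots,n.$$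
   Context: An $A_n$-crystal is a (regular, finite, connected) crystal graph of type $A_n$: a directed graph whose edges are colored $1,\ldots,n$, equivalently the Kashiwara crystal graph of an irreducible integrable highest-weight $U_q(\mathfrak{sl}_{n+1})$-module, where an $i$-colored edge $(u,v)$ means $v=F_i(u)$ for the (partial, invertible) lowering operator $F_i$. Each monochromatic connected component of color $i$ is a directed path. Such a crystal has a unique source $s_K$ (zero indegree); for $c=(c_1,\dots,c_n)\in\mathbb{Z}_+^n$, $K(c)$ denotes the unique $A_n$-crystal in which the maximal $i$-colored path starting at the source has length $c_i$ for every $i$. A subcrystal with color set $I$ means a maximal connected subgraph whose edges have colors in $I$; with colors $\{i,\dots,j\}$ it is itself an $A$-crystal (relabel colors $i,\dots,j$ as $1,\dots,j-i+1$), with its own parameter. Principal lattice: let $\mathcal{B}(c)=\{a\in\mathbb{Z}^n:0\le a\le c\}$. For $1\le k\le n$ let $S_{n,k}=w_{n,k,n-k+1}\cdots w_{n,k,2}w_{n,k,1}$ with $w_{n,k,j}=F_jF_{j+1}\cdots F_{j+k-1}$ (operators applied right to left). The principal vertex at $a\in\mathcal{B}(c)$ is $\pi[a]=S_{n,n}^{a_n}S_{n,n-1}^{a_{n-1}}\cdots S_{n,1}^{a_1}(s_K)$ (all these operators are applicable), and $\Pi=\{\pi[a]:a\in\mathcal{B}(c)\}$, the vertices $\pi[a]$ being distinct. For an $A_{n-1}$-crystal the principal lattice is defined the same way with $n-1$ in place of $n$; for a crystal with colors $2,\ldots,n$, colors $2,\dots,n$ play the roles of $1,\dots,n-1$ and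 the coordinates are indexed $q=(q_2,\ldots,q_n)$, $q_i$ corresponding to the original index $i-1$. Upper subcrystals are the subcrystals of $K$ with colors $1,\ldots,n-1$; lower subcrystals are those with colors $2,\ldots,n$; middle subcrystals are those with colors $2,\ldots,n-1$. It is known that each upper (resp. lower) subcrystal contains exactly one principal vertex of $K$, called its heart; $K^{\uparrow}[a]$ (resp. $K^{\downarrow}[b]$) denotes the upper (resp. lower) subcrystal containing $\pi[a]$ (resp. $\pi[b]$). $K^{\uparrow}[a]\cong K(c^{\uparrow})$ with $c^{\uparrow}_i=c_i-a_i+a_{i+1}$, and the coordinate of $\pi[a]$ in $\Pi^{\uparrow}[a]$ is $h^{\uparrow}=(a_2,\ldots,a_n)$; $K^{\downarrow}[b]$ has parameter $c^{\downarrow}_i=c_i-b_i+b_{i-1}$ ($i=2,\dots,n$), and the coordinate of $\pi[b]$ in $\Pi^{\downarrow}[b]$ is $h^{\downarrow}=(b_1,\ldots,b_{n-1})$ indexed as $h^{\downarrow}_i=b_{i-1}$, $i=2,\dots,n$. Each middle subcrystal is a lower subcrystal of some upper subcrystal and an upper subcrystal of some lower subcrystal, hence contains exactly one vertex of the principal lattice of each. The deviation of a vertex of $\Pi^{\uparrow}[a]$ with coordinate $p$ is $p-h^{\uparrow}$; the deviation of a vertex of $\Pi^{\downarrow}[b]$ with coordinate $q$ is $q-h^{\downarrow}$. *)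

theory Defs
  imports Main
begin

record 'v crystal_graph =
  verts :: "'v set"
  edges :: "nat \<Rightarrow> ('v \<times> 'v) set"

text \<open>Numbers of \<open>i\<close>-coloured edges after and before \<open>v\<close> on the \<open>i\<close>-coloured path through \<open>v\<close>.\<close>

definition head_len :: "('v, 'm) crystal_graph_scheme \<Rightarrow> nat \<Rightarrow> 'v \<Rightarrow> nat" where
  "head_len K i v = Max {m. v \<in> Domain (edges K i ^^ m)}"

definition tail_len :: "('v, 'm) crystal_graph_scheme \<Rightarrow> nat \<Rightarrow> 'v \<Rightarrow> nat" where
  "tail_len K i v = Max {m. v \<in> Range (edges K i ^^ m)}"

text \<open>
  The label of an \<open>i\<close>-coloured edge \<open>(u, v)\<close> with respect to a neighbouring colour \<open>j\<close> is the
  increase of the head length of the \<open>j\<close>-path; by the axioms below it is 0 or 1.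
\<close>

definition edge_label :: "('v, 'm) crystal_graph_scheme \<Rightarrow> nat \<Rightarrow> 'v \<Rightarrow> 'v \<Rightarrow> int" where
  "edge_label K j u v = int (head_len K j v) - int (head_len K j u)"

text \<open>
  Both sides of the equality in question are required to be defined at \<open>u\<close>. For single-valued
  \<open>P\<close>, \<open>Q\<close> the common element of the two relations is unique.
\<close>

definition commute_at :: "'v rel \<Rightarrow> 'v rel \<Rightarrow> 'v \<Rightarrow> bool" where
  "commute_at P Q u \<longleftrightarrow> (\<exists>z. (u, z) \<in> P O Q \<and> (u, z) \<in> Q O P)"

definition remotely_commute_at :: "'v rel \<Rightarrow> 'v rel \<Rightarrow> 'v \<Rightarrow> bool" where
  "remotely_commute_at P Q u \<longleftrightarrow>
    (\<exists>z. (u, z) \<in> P O Q O Q O P \<and> (u, z) \<in> Q O P O P O Q)"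

definition neighbours :: "nat \<Rightarrow> nat \<Rightarrow> bool" where
  "neighbours i j \<longleftrightarrow> i = Suc j \<or> j = Suc i"

text \<open>
  Adjacency, in either direction, through an edge with colour between \<open>lo\<close> and \<open>hi\<close>.
\<close>

definition adjacent :: "('v, 'm) crystal_graph_scheme \<Rightarrow> nat \<Rightarrow> nat \<Rightarrow> 'v rel" where
  "adjacent K lo hi = (\<Union>i\<in>{lo..hi}. edges K i \<union> (edges K i)\<inverse>)"

text \<open>
  Regular crystals of type \<open>A\<^sub>n\<close>, given by Stembridge's local axioms (specialised to the Cartan
  matrix of type \<open>A\<^sub>n\<close>, and in the form used by Danilov, Karzanov and Koshevoy). Finiteness of
  the vertex set together with \<open>single_valued_edges\<close>, \<open>single_valued_converse_edges\<close> and
  \<open>acyclic_edges\<close> says that every monochromatic component is a finite simple directed path.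
\<close>

locale A_crystal =
  fixes n :: nat and K :: "'v crystal_graph"
  assumes finite_verts: "finite (verts K)"
    and verts_nonempty: "verts K \<noteq> {}"
    and edges_in_verts: "edges K i \<subseteq> verts K \<times> verts K"
    and edges_colours: "i \<notin> {1..n} \<Longrightarrow> edges K i = {}"
    and connected: "\<lbrakk>u \<in> verts K; v \<in> verts K\<rbrakk> \<Longrightarrow> (u, v) \<in> (adjacent K 1 n)\<^sup>*"
    and single_valued_edges: "single_valued (edges K i)"
    and single_valued_converse_edges: "single_valued ((edges K i)\<inverse>)"
    and acyclic_edges: "acyclic (edges K i)"
    and tail_antimono:
      "\<lbrakk>i \<in> {1..n}; j \<in> {1..n}; i \<noteq> j; (u, v) \<in> edges K i\<rbrakk> \<Longrightarrow> tail_len K j v \<le> tail_len K j u"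
    and head_mono:
      "\<lbrakk>i \<in> {1..n}; j \<in> {1..n}; i \<noteq> j; (u, v) \<in> edges K i\<rbrakk> \<Longrightarrow> head_len K j u \<le> head_len K j v"
    and cartan:
      "\<lbrakk>i \<in> {1..n}; j \<in> {1..n}; i \<noteq> j; (u, v) \<in> edges K i\<rbrakk> \<Longrightarrow>
        (int (tail_len K j u) - int (tail_len K j v)) + (int (head_len K j v) - int (head_len K j u))
          = (if neighbours i j then 1 else 0)"
    and head_convex:
      "\<lbrakk>i \<in> {1..n}; j \<in> {1..n}; i \<noteq> j; (u, v) \<in> edges K i; (v, w) \<in> edges K i\<rbrakk> \<Longrightarrow>
        2 * head_len K j v \<le> head_len K j u + head_len K j w"
    and commute_out:
      "\<lbrakk>i \<in> {1..n}; j \<in> {1..n}; neighbours i j; (u, v) \<in> edges K i; (u, v') \<in> edges K j;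
        edge_label K j u v = 0\<rbrakk> \<Longrightarrow>
        edge_label K i u v' = 1 \<and> commute_at (edges K i) (edges K j) u"
    and commute_in:
      "\<lbrakk>i \<in> {1..n}; j \<in> {1..n}; neighbours i j; (u, v) \<in> edges K i; (u', v) \<in> edges K j;
        edge_label K j u v = 1\<rbrakk> \<Longrightarrow>
        edge_label K i u' v = 0 \<and> commute_at ((edges K i)\<inverse>) ((edges K j)\<inverse>) v"
    and remotely_commute_out:
      "\<lbrakk>i \<in> {1..n}; j \<in> {1..n}; neighbours i j; (u, v) \<in> edges K i; (u, v') \<in> edges K j;
        edge_label K j u v = 1; edge_label K i u v' = 1\<rbrakk> \<Longrightarrow>
        remotely_commute_at (edges K i) (edges K j) u"
    and remotely_commute_in:
      "\<lbrakk>i \<in> {1..n}; j \<in> {1..n}; neighbours i j; (u, v) \<in> edges K i; (u', v) \<in> edges K j;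
        edge_label K j u v = 0; edge_label K i u' v = 0\<rbrakk> \<Longrightarrow>
        remotely_commute_at ((edges K i)\<inverse>) ((edges K j)\<inverse>) v"
    and far_commute:
      "\<lbrakk>i \<in> {1..n}; j \<in> {1..n}; i \<noteq> j; \<not> neighbours i j;
        P \<in> {edges K i, (edges K i)\<inverse>}; Q \<in> {edges K j, (edges K j)\<inverse>};
        u \<in> Domain P; u \<in> Domain Q\<rbrakk> \<Longrightarrow> commute_at P Q u"

definition source :: "('v, 'm) crystal_graph_scheme \<Rightarrow> 'v" where
  "source K = (THE s. s \<in> verts K \<and> (\<forall>i. s \<notin> Range (edges K i)))"

definition parameter :: "('v, 'm) crystal_graph_scheme \<Rightarrow> nat \<Rightarrow> nat" where
  "parameter K i = head_len K i (source K)"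

text \<open>
  The component of \<open>v\<close> with respect to the colours \<open>lo, \<dots>, hi\<close>, with these colours relabelled
  as \<open>1, \<dots>, hi - lo + 1\<close>. For \<open>hi < lo\<close> this is the single vertex \<open>v\<close>.
\<close>

definition subcrystal :: "'v crystal_graph \<Rightarrow> nat \<Rightarrow> nat \<Rightarrow> 'v \<Rightarrow> 'v crystal_graph" where
  "subcrystal K lo hi v =
    (let C = (adjacent K lo hi)\<^sup>* `` {v}
     in \<lparr>verts = C,
         edges = (\<lambda>k. if 1 \<le> k \<and> lo + k - 1 \<le> hi then edges K (lo + k - 1) \<inter> C \<times> C else {})\<rparr>)"

definition upper_subcrystal :: "nat \<Rightarrow> 'v crystal_graph \<Rightarrow> 'v \<Rightarrow> 'v crystal_graph" where
  "upper_subcrystal n K v = subcrystal K 1 (n - 1) v"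

definition lower_subcrystal :: "nat \<Rightarrow> 'v crystal_graph \<Rightarrow> 'v \<Rightarrow> 'v crystal_graph" where
  "lower_subcrystal n K v = subcrystal K 2 n v"

definition middle_subcrystal :: "nat \<Rightarrow> 'v crystal_graph \<Rightarrow> 'v \<Rightarrow> 'v crystal_graph" where
  "middle_subcrystal n K v = subcrystal K 2 (n - 1) v"

definition lowering :: "('v, 'm) crystal_graph_scheme \<Rightarrow> nat \<Rightarrow> 'v \<Rightarrow> 'v option" where
  "lowering K i u = (if u \<in> Domain (edges K i) then Some (THE v. (u, v) \<in> edges K i) else None)"

text \<open>
  Product of a list of partial operators, applied right to left (the last one acts first).
\<close>

definition op_prod :: "('v \<Rightarrow> 'v option) list \<Rightarrow> 'v \<Rightarrow> 'v option" where
  "op_prod fs = foldr (\<circ>\<^sub>m) fs Some"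

text \<open>
  \<open>w_op K k j\<close> is \<open>F\<^sub>j F\<^sub>j\<^sub>+\<^sub>1 \<dots> F\<^sub>j\<^sub>+\<^sub>k\<^sub>-\<^sub>1\<close>; it does not depend on \<open>n\<close>.
\<close>

definition w_op :: "('v, 'm) crystal_graph_scheme \<Rightarrow> nat \<Rightarrow> nat \<Rightarrow> 'v \<Rightarrow> 'v option" where
  "w_op K k j = op_prod (map (lowering K) [j..<j + k])"

definition S_op :: "nat \<Rightarrow> ('v, 'm) crystal_graph_scheme \<Rightarrow> nat \<Rightarrow> 'v \<Rightarrow> 'v option" where
  "S_op n K k = op_prod (map (w_op K k) (rev [1..<n - k + 2]))"

definition principal_vertex ::
    "nat \<Rightarrow> ('v, 'm) crystal_graph_scheme \<Rightarrow> (nat \<Rightarrow> int) \<Rightarrow> 'v option" where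
  "principal_vertex n K a =
    op_prod (map (\<lambda>k. op_prod (replicate (nat (a k)) (S_op n K k))) (rev [1..<Suc n])) (source K)"

text \<open>Integer vectors are functions of which only the values at \<open>1, \<dots>, n\<close> are relevant.\<close>

definition box :: "nat \<Rightarrow> (nat \<Rightarrow> nat) \<Rightarrow> (nat \<Rightarrow> int) set" where
  "box n c = {a. \<forall>i\<in>{1..n}. 0 \<le> a i \<and> a i \<le> int (c i)}"

definition has_coordinate ::
    "nat \<Rightarrow> ('v, 'm) crystal_graph_scheme \<Rightarrow> 'v \<Rightarrow> (nat \<Rightarrow> int) \<Rightarrow> bool" where
  "has_coordinate n K v a \<longleftrightarrow> a \<in> box n (parameter K) \<and> principal_vertex n K a = Some v"

definition has_upper_coordinate :: "nat \<Rightarrow> 'v crystal_graph \<Rightarrow> 'v \<Rightarrow> (nat \<Rightarrow> int) \<Rightarrow> bool" where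
  "has_upper_coordinate n U v p \<longleftrightarrow> has_coordinate (n - 1) U v p"

text \<open>
  In a lower subcrystal of an \<open>A\<^sub>n\<close>-crystal the coordinates are indexed by the original colours
  \<open>2, \<dots>, n\<close>, whereas \<open>subcrystal\<close> relabels these colours as \<open>1, \<dots>, n - 1\<close>.
\<close>

definition has_lower_coordinate :: "nat \<Rightarrow> 'v crystal_graph \<Rightarrow> 'v \<Rightarrow> (nat \<Rightarrow> int) \<Rightarrow> bool" where
  "has_lower_coordinate n L v q \<longleftrightarrow> has_coordinate (n - 1) L v (\<lambda>i. q (Suc i))"

end

theory Submission
  imports Defs
begin

text \<open>
  Let \<open>L\<close> and \<open>K\<close> be crystals whose parameters satisfy \<open>param L \<le> param K\<close>. Then the source of \<open>L\<close>
  extends to an edge-preserving map \<open>L \<rightarrow> K\<close> which preserves tail lengths and increases the head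
  lengths by \<open>param K - param L\<close>. Now \<open>\<pi>[a]\<close> in \<open>K(a)\<close> is the sink, as one sees in a realisation of
  \<open>K(a)\<close> by words, in which \<open>S\<^sub>n\<^sub>,\<^sub>k\<close> turns a factor \<open>1 2 \<dots> k\<close> into \<open>n-k+2 \<dots> n+1\<close>.

  The map \<open>K(a) \<rightarrow> K(c)\<close> therefore gives \<open>\<pi>[a]\<close> the head lengths \<open>c\<^sub>i - a\<^sub>i\<close> and the tail lengths
  \<open>a\<^sub>n\<^sub>+\<^sub>1\<^sub>-\<^sub>i\<close>. Moreover, the sink of \<open>K(a)\<close> is also the sink of its subcrystal on the colours \<open>lo..hi\<close>,
  and this determines the parameter of that subcrystal; transporting its source to \<open>K(c)\<close> yields the
  parameters \<open>c\<^sub>i - a\<^sub>i + a\<^sub>i\<^sub>+\<^sub>1\<close> of the upper and \<open>c\<^sub>i - b\<^sub>i + b\<^sub>i\<^sub>-\<^sub>1\<close> of the lower subcrystals.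

  Computing the parameter of the middle subcrystal in both ways shows that
  \<open>\<nabla>\<^sub>i\<^sub>+\<^sub>1 + \<Delta>\<^sub>i\<close> does not depend on \<open>i\<close>. The weight functionals \<open>\<Sum> j wt\<^sub>j\<close> and \<open>\<Sum> (n+1-j) wt\<^sub>j\<close> are
  constant on upper and on lower subcrystals, respectively; since the weight of \<open>\<pi>[a]\<close> minus \<open>c\<close> is
  symmetric, this forces \<open>\<Sum> (\<nabla>\<^sub>i\<^sub>+\<^sub>1 + \<Delta>\<^sub>i) = 0\<close>.
\<close>

section \<open>Head and tail lengths\<close>

text \<open>Head and tail lengths are one notion applied to an edge relation and to its converse, so
  each fact about \<open>depth\<close> serves for both.\<close>

definition depth :: "'v rel \<Rightarrow> 'v \<Rightarrow> nat" where
  "depth R u = Max {m. u \<in> Domain (R ^^ m)}"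

lemma head_len_depth: "head_len K i = depth (edges K i)"
  by (rule ext) (simp add: head_len_def depth_def)

lemma Range_relpow_converse: "Range ((R :: 'v rel) ^^ m) = Domain ((R\<inverse>) ^^ m)"
proof -
  have "(R\<inverse>) ^^ m = (R ^^ m)\<inverse>"
  proof (induction m)
    case (Suc m)
    then show ?case using converse_relcomp[of R "R ^^ m"] relpow_commute[of R m] by simp
  qed simp
  then show ?thesis by auto
qed

lemma tail_len_depth: "tail_len K i = depth ((edges K i)\<inverse>)"
  by (rule ext) (simp add: tail_len_def depth_def Range_relpow_converse)

text \<open>Along \<open>m\<close> steps of \<open>R\<close> the value \<open>h\<close> falls by
  exactly \<open>m\<close>, so it bounds all walks from \<open>u\<close>; and a walk can be
  prolonged as long as \<open>h\<close> is positive. Lengths in subcrystals and in words are read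
  off this way.\<close>

lemma depth_eqI:
  fixes R :: "'v rel"
  assumes closed: "R \<subseteq> C \<times> C" and step: "\<And>u v. (u, v) \<in> R \<Longrightarrow> h u = Suc (h v)"
    and dom: "\<And>u. u \<in> C \<Longrightarrow> 0 < h u \<Longrightarrow> u \<in> Domain R" and u: "u \<in> C"
  shows "depth R u = h u"
proof -
  have le: "m \<le> h u" if "(u, v) \<in> R ^^ m" for u v m
  proof -
    have "h u = m + h v" using that
      by (induction m arbitrary: v) (auto simp: step dest: step)
    then show ?thesis by simp
  qed
  have ex: "u \<in> Domain (R ^^ h u)" if "u \<in> C" for u
    using that
  proof (induction "h u" arbitrary: u)
    case 0
    then show ?case by simp
  next
    case (Suc k)
    then obtain v where v: "(u, v) \<in> R" using dom[of u] by auto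
    then have "v \<in> C" "h v = k" using closed step[OF v] Suc(2) by auto
    then have "v \<in> Domain (R ^^ k)" using Suc by auto
    then have "u \<in> Domain (R ^^ Suc k)" using v by (blast intro: relpow_Suc_I2)
    then show ?case using Suc(2) by simp
  qed
  show ?thesis unfolding depth_def
    by (rule Max_eqI) (use le ex[OF u] in \<open>auto intro: finite_subset[of _ "{..h u}"]\<close>)
qed

lemma relpow_Suc_front: "(R :: 'v rel) ^^ Suc k = R O R ^^ k"
  by (simp add: relpow_commute)

lemma depth_set_step:
  fixes R :: "'v rel"
  assumes "single_valued R" "(u, v) \<in> R"
  shows "{m. u \<in> Domain (R ^^ m)} = insert 0 (Suc ` {m. v \<in> Domain (R ^^ m)})"
proof -
  have "u \<in> Domain (R ^^ Suc k) \<longleftrightarrow> v \<in> Domain (R ^^ k)" for k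
    unfolding relpow_Suc_front using assms single_valuedD[OF assms] by blast
  then have "m \<in> {m. u \<in> Domain (R ^^ m)} \<longleftrightarrow> m \<in> insert 0 (Suc ` {m. v \<in> Domain (R ^^ m)})" for m
    by (cases m) (auto simp del: relpow.simps(2))
  then show ?thesis by blast
qed

lemma depth_set_end:
  fixes R :: "'v rel"
  assumes "u \<notin> Domain R"
  shows "{m. u \<in> Domain (R ^^ m)} = {0}"
proof -
  have "u \<notin> Domain (R ^^ Suc k)" for k
    unfolding relpow_Suc_front using assms by blast
  then have "m \<in> {m. u \<in> Domain (R ^^ m)} \<longleftrightarrow> m = 0" for m
    by (cases m) (auto simp del: relpow.simps(2))
  then show ?thesis by blast
qed

lemma finite_depth_set:
  fixes R :: "'v rel"
  assumes "single_valued R" "wf (R\<inverse>)"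
  shows "finite {m. u \<in> Domain (R ^^ m)}"
  using assms(2)
proof (induction u rule: wf_induct_rule)
  case (less u)
  show ?case
  proof (cases "u \<in> Domain R")
    case True
    then obtain v where "(u, v) \<in> R" by auto
    then show ?thesis using less depth_set_step[OF assms(1)] by (metis (no_types, lifting) converseI finite_imageI finite_insert)
  qed (simp add: depth_set_end)
qed

lemma depth_step:
  assumes "single_valued R" "wf (R\<inverse>)" "(u, v) \<in> R"
  shows "depth R u = Suc (depth R v)"
proof -
  have "v \<in> Domain (R ^^ 0)" by simp
  then have ne: "{m. v \<in> Domain (R ^^ m)} \<noteq> {}" by blast
  then show ?thesis
    unfolding depth_def depth_set_step[OF assms(1,3)]
    using finite_depth_set[OF assms(1,2), of v]
    by (simp add: mono_Max_commute[symmetric] mono_Suc)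
qed

lemma depth_pos:
  assumes "single_valued R" "wf (R\<inverse>)"
  shows "0 < depth R u \<longleftrightarrow> u \<in> Domain R"
proof
  assume "0 < depth R u"
  then show "u \<in> Domain R" using depth_set_end[of u R] by (force simp: depth_def)
qed (use depth_step[OF assms] in auto)

text \<open>
  Connectedness is dropped so that the graph of all words of a given length qualifies.
\<close>

locale A_precrystal =
  fixes n :: nat and K :: "'v crystal_graph"
  assumes finite_verts: "finite (verts K)"
    and edges_in_verts: "edges K i \<subseteq> verts K \<times> verts K"
    and edges_colours: "i \<notin> {1..n} \<Longrightarrow> edges K i = {}"
    and single_valued_edges: "single_valued (edges K i)"
    and single_valued_converse_edges: "single_valued ((edges K i)\<inverse>)"
    and acyclic_edges: "acyclic (edges K i)"
    and neighbour_change: "\<lbrakk>i \<in> {1..n}; j \<in> {1..n}; neighbours i j; (u, v) \<in> edges K i\<rbrakk> \<Longrightarrow>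
        tail_len K j u = Suc (tail_len K j v) \<and> head_len K j v = head_len K j u \<or>
        tail_len K j v = tail_len K j u \<and> head_len K j v = Suc (head_len K j u)"
    and far_change: "\<lbrakk>i \<in> {1..n}; j \<in> {1..n}; i \<noteq> j; \<not> neighbours i j; (u, v) \<in> edges K i\<rbrakk> \<Longrightarrow>
        tail_len K j v = tail_len K j u \<and> head_len K j v = head_len K j u"
    and neighbour_convex:
      "\<lbrakk>i \<in> {1..n}; j \<in> {1..n}; neighbours i j; (u, v) \<in> edges K i; (v, w) \<in> edges K i\<rbrakk> \<Longrightarrow>
        2 * head_len K j v \<le> head_len K j u + head_len K j w"
    and out0:
      "\<lbrakk>i \<in> {1..n}; j \<in> {1..n}; neighbours i j; (u, v) \<in> edges K i; (u, v') \<in> edges K j;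
        head_len K j v = head_len K j u\<rbrakk> \<Longrightarrow>
        head_len K i v' = Suc (head_len K i u) \<and> commute_at (edges K i) (edges K j) u"
    and in1:
      "\<lbrakk>i \<in> {1..n}; j \<in> {1..n}; neighbours i j; (u, v) \<in> edges K i; (u', v) \<in> edges K j;
        head_len K j v = Suc (head_len K j u)\<rbrakk> \<Longrightarrow>
        head_len K i v = head_len K i u' \<and> commute_at ((edges K i)\<inverse>) ((edges K j)\<inverse>) v"
    and out11:
      "\<lbrakk>i \<in> {1..n}; j \<in> {1..n}; neighbours i j; (u, v) \<in> edges K i; (u, v') \<in> edges K j;
        head_len K j v = Suc (head_len K j u); head_len K i v' = Suc (head_len K i u)\<rbrakk> \<Longrightarrow>
        remotely_commute_at (edges K i) (edges K j) u"
    and in00: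
      "\<lbrakk>i \<in> {1..n}; j \<in> {1..n}; neighbours i j; (u, v) \<in> edges K i; (u', v) \<in> edges K j;
        head_len K j v = head_len K j u; head_len K i v = head_len K i u'\<rbrakk> \<Longrightarrow>
        remotely_commute_at ((edges K i)\<inverse>) ((edges K j)\<inverse>) v"
    and far_commute:
      "\<lbrakk>i \<in> {1..n}; j \<in> {1..n}; i \<noteq> j; \<not> neighbours i j;
        P \<in> {edges K i, (edges K i)\<inverse>}; Q \<in> {edges K j, (edges K j)\<inverse>};
        u \<in> Domain P; u \<in> Domain Q\<rbrakk> \<Longrightarrow> commute_at P Q u"

lemma neighbours_neq: "neighbours i j \<Longrightarrow> i \<noteq> j"
  by (auto simp: neighbours_def)

lemma neighbours_sym: "neighbours i j \<Longrightarrow> neighbours j i"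
  by (auto simp: neighbours_def)

lemma A_crystal_precrystal:
  assumes "A_crystal n K"
  shows "A_precrystal n K"
proof -
  interpret A_crystal n K by fact
  show ?thesis
  proof (unfold_locales, goal_cases)
    case 1 then show ?case by (rule finite_verts)
  next
    case 2 then show ?case by (rule edges_in_verts)
  next
    case 3 then show ?case by (rule edges_colours)
  next
    case 4 then show ?case by (rule single_valued_edges)
  next
    case 5 then show ?case by (rule single_valued_converse_edges)
  next
    case 6 then show ?case by (rule acyclic_edges)
  next
    case (7 i j u v)
    note h = 7(1,2) neighbours_neq[OF 7(3)] 7(4)
    \<comment> \<open>Two nonnegative differences with sum 1: one is 1 and the other 0. In the next
      case the sum is 0 and both vanish.\<close>
    show ?case using cartan[OF h] tail_antimono[OF h] head_mono[OF h] unfolding if_P[OF 7(3)] by linarith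
  next
    case (8 i j u v)
    note h = 8(1-3,5)
    show ?case using cartan[OF h] tail_antimono[OF h] head_mono[OF h] unfolding if_not_P[OF 8(4)] by linarith
  next
    case (9 i j u v w)
    then show ?case using head_convex[of i j u v w] neighbours_neq by blast
  next
    case (10 i j u v v')
    then show ?case using commute_out[of i j u v v'] by (auto simp: edge_label_def)
  next
    case (11 i j u v u')
    then show ?case using commute_in[of i j u v u'] by (auto simp: edge_label_def)
  next
    case (12 i j u v v')
    then show ?case using remotely_commute_out[of i j u v v'] by (auto simp: edge_label_def)
  next
    case (13 i j u v u')
    then show ?case using remotely_commute_in[of i j u v u'] by (auto simp: edge_label_def)
  next
    case 14
    then show ?case by (rule far_commute)
  qed
qed

context A_precrystal
begin

lemma finite_edges: "finite (edges K i)"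
  by (rule finite_subset[OF edges_in_verts]) (simp add: finite_verts)

lemma wf_edges: "wf (edges K i)" "wf ((edges K i)\<inverse>)"
  using finite_acyclic_wf finite_acyclic_wf_converse finite_edges acyclic_edges by auto

lemma head_step: "(u, v) \<in> edges K i \<Longrightarrow> head_len K i u = Suc (head_len K i v)"
  unfolding head_len_depth by (rule depth_step) (simp_all add: single_valued_edges wf_edges)

lemma tail_step: "(u, v) \<in> edges K i \<Longrightarrow> tail_len K i v = Suc (tail_len K i u)"
  unfolding tail_len_depth by (rule depth_step) (simp_all add: single_valued_converse_edges wf_edges)

lemma head_pos: "0 < head_len K i u \<longleftrightarrow> (\<exists>v. (u, v) \<in> edges K i)"
  unfolding head_len_depth using depth_pos[OF single_valued_edges wf_edges(2)] by auto

lemma tail_pos: "0 < tail_len K i v \<longleftrightarrow> (\<exists>u. (u, v) \<in> edges K i)"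
  unfolding tail_len_depth using depth_pos[OF single_valued_converse_edges] wf_edges by force

lemma edge_colour: "(u, v) \<in> edges K i \<Longrightarrow> i \<in> {1..n}"
  using edges_colours by fastforce

lemma edge_unique: "(u, v) \<in> edges K i \<Longrightarrow> (u, v') \<in> edges K i \<Longrightarrow> v' = v"
  using single_valued_edges by (metis single_valuedD)

lemma edge_unique': "(u, v) \<in> edges K i \<Longrightarrow> (u', v) \<in> edges K i \<Longrightarrow> u' = u"
  using single_valued_converse_edges by (metis single_valuedD converseI)

section \<open>Weights and linear functionals on them\<close>

definition wt :: "nat \<Rightarrow> 'v \<Rightarrow> int" where
  "wt i v = int (head_len K i v) - int (tail_len K i v)"

text \<open>An edge of colour \<open>i\<close> subtracts the \<open>i\<close>-th simple root, whose
  coordinates are a row of the Cartan matrix.\<close>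

lemma wt_step:
  assumes "(u, v) \<in> edges K i" "j \<in> {1..n}"
  shows "wt j v = wt j u - (if i = j then 2 else if neighbours i j then -1 else 0)"
proof -
  have i: "i \<in> {1..n}" using edge_colour[OF assms(1)] .
  consider "i = j" | "i \<noteq> j" "neighbours i j" | "i \<noteq> j" "\<not> neighbours i j" by blast
  then show ?thesis
  proof cases
    case 1
    then show ?thesis using head_step[OF assms(1)] tail_step[OF assms(1)] by (simp add: wt_def)
  next
    case 2
    then show ?thesis using neighbour_change[OF i assms(2) 2(2) assms(1)] by (auto simp: wt_def)
  next
    case 3
    then show ?thesis using far_change[OF i assms(2) 3 assms(1)] by (auto simp: wt_def)
  qed
qed

text \<open>The drop along an edge is the pairing of \<open>f\<close> with a simple root, a negated
  second difference of \<open>f\<close>. The zero boundary values make the formula uniform at the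
  colours 1 and \<open>n\<close>; where \<open>f\<close> is affine the functional does not
  change.\<close>

lemma sum_wt_step:
  assumes e: "(u, v) \<in> edges K i" and f: "f 0 = (0::int)" "f (Suc n) = 0"
  shows "(\<Sum>j=1..n. f j * wt j v) = (\<Sum>j=1..n. f j * wt j u) - (2 * f i - f (i - 1) - f (Suc i))"
proof -
  have i: "i \<in> {1..n}" using edge_colour[OF e] .
  let ?d = "\<lambda>j. if i = j then 2 else if neighbours i j then -1 else (0::int)"
  have "(\<Sum>j=1..n. f j * wt j v) = (\<Sum>j=1..n. f j * wt j u - f j * ?d j)"
    by (rule sum.cong) (simp_all only: wt_step[OF e] right_diff_distrib)
  also have "\<dots> = (\<Sum>j=1..n. f j * wt j u) - (\<Sum>j=1..n. f j * ?d j)"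
    by (rule sum_subtractf)
  also have "(\<Sum>j=1..n. f j * ?d j) = (\<Sum>j\<in>{0..Suc n}. f j * ?d j)"
    by (rule sum.mono_neutral_left) (use f in \<open>auto simp: not_less_eq_eq le_Suc_eq\<close>)
  also have "\<dots> = (\<Sum>j\<in>{i - 1, i, Suc i}. f j * ?d j)"
    by (rule sum.mono_neutral_right) (use i in \<open>auto simp: neighbours_def\<close>)
  also have "\<dots> = 2 * f i - f (i - 1) - f (Suc i)"
    using i by (cases i) (auto simp: neighbours_def)
  finally show ?thesis .
qed

end

section \<open>Subcrystals\<close>

lemma commute_at_restrict:
  assumes "commute_at P Q u" "u \<in> C"
    and "\<And>x y. (x, y) \<in> P \<Longrightarrow> x \<in> C \<Longrightarrow> y \<in> C" "\<And>x y. (x, y) \<in> Q \<Longrightarrow> x \<in> C \<Longrightarrow> y \<in> C"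
  shows "commute_at (P \<inter> C \<times> C) (Q \<inter> C \<times> C) u"
proof -
  obtain z x y where "(u, x) \<in> P" "(x, z) \<in> Q" "(u, y) \<in> Q" "(y, z) \<in> P"
    using assms(1) by (auto simp: commute_at_def)
  moreover from this have "x \<in> C" "y \<in> C" "z \<in> C" using assms(2-) by blast+
  ultimately show ?thesis using assms(2) unfolding commute_at_def by blast
qed

lemma remotely_commute_at_restrict:
  assumes "remotely_commute_at P Q u" "u \<in> C"
    and "\<And>x y. (x, y) \<in> P \<Longrightarrow> x \<in> C \<Longrightarrow> y \<in> C" "\<And>x y. (x, y) \<in> Q \<Longrightarrow> x \<in> C \<Longrightarrow> y \<in> C"
  shows "remotely_commute_at (P \<inter> C \<times> C) (Q \<inter> C \<times> C) u"
proof -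
  obtain z x1 x2 x3 y1 y2 y3 where
    "(u, x1) \<in> P" "(x1, x2) \<in> Q" "(x2, x3) \<in> Q" "(x3, z) \<in> P"
    "(u, y1) \<in> Q" "(y1, y2) \<in> P" "(y2, y3) \<in> P" "(y3, z) \<in> Q"
    using assms(1) by (auto simp: remotely_commute_at_def)
  moreover from this have "x1 \<in> C" "x2 \<in> C" "x3 \<in> C" "y1 \<in> C" "y2 \<in> C" "y3 \<in> C" "z \<in> C"
    using assms(2-) by metis+
  ultimately show ?thesis using assms(2) unfolding remotely_commute_at_def by blast
qed

lemma sym_adjacent: "sym (adjacent K lo hi)"
  by (auto simp: adjacent_def sym_def)

lemma adjacentI: "i \<in> {lo..hi} \<Longrightarrow> (u, v) \<in> edges K i \<Longrightarrow> (u, v) \<in> adjacent K lo hi"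
  by (auto simp: adjacent_def)

text \<open>\<open>lo \<le> Suc hi\<close> also admits the empty colour interval, for which the
  component is a single vertex.\<close>

locale subcrystal_at = A_precrystal +
  fixes lo hi :: nat and v0 :: 'a
  assumes v0: "v0 \<in> verts K" and range: "1 \<le> lo" "lo \<le> Suc hi" "hi \<le> n"
begin

definition "C = (adjacent K lo hi)\<^sup>* `` {v0}"
abbreviation "S \<equiv> subcrystal K lo hi v0"
abbreviation "N \<equiv> Suc hi - lo"
abbreviation "\<sigma> k \<equiv> lo + k - 1"

lemma verts_S: "verts S = C"
  by (simp add: subcrystal_def C_def Let_def)

lemma edges_S: "k \<in> {1..N} \<Longrightarrow> edges S k = edges K (\<sigma> k) \<inter> C \<times> C"
  using range by (auto simp: subcrystal_def C_def Let_def)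

lemma edges_S': "k \<notin> {1..N} \<Longrightarrow> edges S k = {}"
  using range by (auto simp: subcrystal_def C_def Let_def)

lemma \<sigma>: "k \<in> {1..N} \<Longrightarrow> \<sigma> k \<in> {1..n}" "k \<in> {1..N} \<Longrightarrow> \<sigma> k \<in> {lo..hi}"
  using range by auto

lemma closed:
  assumes "k \<in> {1..N}" "(u, v) \<in> edges K (\<sigma> k)"
  shows "u \<in> C \<longleftrightarrow> v \<in> C"
proof -
  have "(u, v) \<in> adjacent K lo hi" by (rule adjacentI[OF \<sigma>(2)[OF assms(1)] assms(2)])
  then show ?thesis unfolding C_def using symD[OF sym_adjacent, of u v]
    by (auto intro: rtrancl_into_rtrancl)
qed

lemma C_verts: "C \<subseteq> verts K"
proof
  fix u assume "u \<in> C"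
  then have "(v0, u) \<in> (adjacent K lo hi)\<^sup>*" by (simp add: C_def)
  then show "u \<in> verts K"
    by induction (use v0 edges_in_verts in \<open>auto simp: adjacent_def\<close>)
qed

text \<open>With each vertex, \<open>C\<close> contains the whole strings of colours
  \<open>lo..hi\<close> through it, so restricting the relation to \<open>C\<close> leaves their
  lengths unchanged.\<close>

lemma head_S: assumes "u \<in> C" "k \<in> {1..N}" shows "head_len S k u = head_len K (\<sigma> k) u"
  unfolding head_len_depth[of S] edges_S[OF assms(2)]
proof (rule depth_eqI[OF _ _ _ assms(1)])
  fix u assume u: "u \<in> C" "0 < head_len K (\<sigma> k) u"
  then show "u \<in> Domain (edges K (\<sigma> k) \<inter> C \<times> C)"
    using head_pos[of "\<sigma> k" u] closed[OF assms(2)] by blast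
qed (use head_step in auto)

lemma tail_S: assumes "u \<in> C" "k \<in> {1..N}" shows "tail_len S k u = tail_len K (\<sigma> k) u"
  unfolding tail_len_depth[of S] edges_S[OF assms(2)]
proof (rule depth_eqI[OF _ _ _ assms(1)])
  fix u assume u: "u \<in> C" "0 < tail_len K (\<sigma> k) u"
  then show "u \<in> Domain ((edges K (\<sigma> k) \<inter> C \<times> C)\<inverse>)"
    using tail_pos[of "\<sigma> k" u] closed[OF assms(2)] by blast
qed (use tail_step in auto)

lemma edge_S_iff: "(u, v) \<in> edges S k \<longleftrightarrow> k \<in> {1..N} \<and> u \<in> C \<and> v \<in> C \<and> (u, v) \<in> edges K (\<sigma> k)"
  by (cases "k \<in> {1..N}") (auto simp del: atLeastAtMost_iff simp: edges_S edges_S')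

lemma neighbours_\<sigma>: "k \<in> {1..N} \<Longrightarrow> l \<in> {1..N} \<Longrightarrow> neighbours (\<sigma> k) (\<sigma> l) = neighbours k l"
  using range by (auto simp: neighbours_def)

lemma \<sigma>_neq: "k \<in> {1..N} \<Longrightarrow> l \<in> {1..N} \<Longrightarrow> k \<noteq> l \<Longrightarrow> \<sigma> k \<noteq> \<sigma> l"
  using range by auto

lemma converse_edges_S: "k \<in> {1..N} \<Longrightarrow> (edges S k)\<inverse> = (edges K (\<sigma> k))\<inverse> \<inter> C \<times> C"
  by (auto simp: edges_S)

lemma connected_S: assumes "u \<in> C" "w \<in> C" shows "(u, w) \<in> (adjacent S 1 N)\<^sup>*"
proof -
  have *: "(v0, x) \<in> (adjacent S 1 N)\<^sup>*" if "(v0, x) \<in> (adjacent K lo hi)\<^sup>*" for x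
    using that
  proof induction
    case (step x y)
    then have C: "x \<in> C" "y \<in> C" by (auto simp: C_def)
    obtain i where i: "i \<in> {lo..hi}" "(x, y) \<in> edges K i \<or> (y, x) \<in> edges K i"
      using step(2) by (auto simp: adjacent_def)
    have k: "Suc i - lo \<in> {1..N}" "\<sigma> (Suc i - lo) = i" using i range by auto
    then have "(x, y) \<in> edges S (Suc i - lo) \<or> (y, x) \<in> edges S (Suc i - lo)"
      unfolding edges_S[OF k(1)] k(2) using i C by blast
    then have "(x, y) \<in> adjacent S 1 N" using k(1) by (auto simp: adjacent_def)
    with step show ?case by simp
  qed simp
  have "(v0, u) \<in> (adjacent S 1 N)\<^sup>*" "(v0, w) \<in> (adjacent S 1 N)\<^sup>*"
    using * assms by (auto simp: C_def)
  then show ?thesis using sym_rtrancl[OF sym_adjacent] by (metis rtrancl_trans symD)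
qed

lemma v0_C: "v0 \<in> C" by (simp add: C_def)

text \<open>The axioms are local: by \<open>closed\<close>, every string, square and octagon in
  colours \<open>lo..hi\<close> through a vertex of \<open>C\<close> stays in \<open>C\<close>, and
  the translation \<open>\<sigma>\<close> of colours preserves neighbours.\<close>

theorem A_crystal_S: "A_crystal N S"
proof (unfold_locales, goal_cases)
  case 1
  then show ?case using C_verts finite_verts finite_subset verts_S by metis
next
  case 2
  then show ?case using verts_S v0_C by auto
next
  case (3 i)
  then show ?case unfolding verts_S by (auto simp: edge_S_iff)
next
  case 4
  then show ?case by (rule edges_S')
next
  case 5
  then show ?case unfolding verts_S by (rule connected_S)
next
  case 6
  then show ?case using edge_unique by (auto simp: single_valued_def edge_S_iff)
next
  case 7
  then show ?case using edge_unique' by (auto simp: single_valued_def edge_S_iff)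
next
  case (8 i)
  have "edges S i \<subseteq> edges K (\<sigma> i)" by (auto simp: edge_S_iff)
  then show ?case using acyclic_edges acyclic_subset by blast
next
  case (9 i j u v)
  then have e: "u \<in> C" "v \<in> C" "(u, v) \<in> edges K (\<sigma> i)" by (auto simp: edge_S_iff)
  note ij = 9(1,2)[THEN \<sigma>(1)] \<sigma>_neq[OF 9(1-3)]
  show ?case unfolding tail_S[OF e(1) 9(2)] tail_S[OF e(2) 9(2)]
    using neighbour_change[OF ij(1,2) _ e(3)] far_change[OF ij(1-3) _ e(3)] by fastforce
next
  case (10 i j u v)
  then have e: "u \<in> C" "v \<in> C" "(u, v) \<in> edges K (\<sigma> i)" by (auto simp: edge_S_iff)
  note ij = 10(1,2)[THEN \<sigma>(1)] \<sigma>_neq[OF 10(1-3)]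
  show ?case unfolding head_S[OF e(1) 10(2)] head_S[OF e(2) 10(2)]
    using neighbour_change[OF ij(1,2) _ e(3)] far_change[OF ij(1-3) _ e(3)] by fastforce
next
  case (11 i j u v)
  then have e: "u \<in> C" "v \<in> C" "(u, v) \<in> edges K (\<sigma> i)" by (auto simp: edge_S_iff)
  note ij = 11(1,2)[THEN \<sigma>(1)] \<sigma>_neq[OF 11(1-3)]
  show ?case unfolding head_S[OF e(1) 11(2)] head_S[OF e(2) 11(2)] tail_S[OF e(1) 11(2)] tail_S[OF e(2) 11(2)]
    using neighbour_change[OF ij(1,2) _ e(3)] far_change[OF ij(1-3) _ e(3)] neighbours_\<sigma>[OF 11(1,2)]
    by (cases "neighbours i j") auto
next
  case (12 i j u v w)
  then have e: "u \<in> C" "v \<in> C" "w \<in> C" "(u, v) \<in> edges K (\<sigma> i)" "(v, w) \<in> edges K (\<sigma> i)"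
    by (auto simp: edge_S_iff)
  note ij = 12(1,2)[THEN \<sigma>(1)] \<sigma>_neq[OF 12(1-3)]
  show ?case unfolding head_S[OF e(1) 12(2)] head_S[OF e(2) 12(2)] head_S[OF e(3) 12(2)]
    using neighbour_convex[OF ij(1,2) _ e(4,5)] far_change[OF ij(1-3) _ e(4)] far_change[OF ij(1-3) _ e(5)]
    by (cases "neighbours (\<sigma> i) (\<sigma> j)") auto
next
  case (13 i j u v v')
  then have e: "u \<in> C" "v \<in> C" "v' \<in> C" "(u, v) \<in> edges K (\<sigma> i)" "(u, v') \<in> edges K (\<sigma> j)"
    by (auto simp: edge_S_iff)
  note ij = 13(1,2)[THEN \<sigma>(1)] 13(3)[folded neighbours_\<sigma>[OF 13(1,2)]]
  note h = head_S[OF e(1) 13(1)] head_S[OF e(3) 13(1)] head_S[OF e(1) 13(2)] head_S[OF e(2) 13(2)]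
  have "head_len K (\<sigma> i) v' = Suc (head_len K (\<sigma> i) u) \<and> commute_at (edges K (\<sigma> i)) (edges K (\<sigma> j)) u"
    by (rule out0[OF ij e(4,5)]) (use 13(6) in \<open>simp add: edge_label_def h\<close>)
  then show ?case unfolding edge_label_def h edges_S[OF 13(1)] edges_S[OF 13(2)]
    using e(1) closed[OF 13(1)] closed[OF 13(2)] by (auto intro: commute_at_restrict)
next
  case (14 i j u v u')
  then have e: "u \<in> C" "v \<in> C" "u' \<in> C" "(u, v) \<in> edges K (\<sigma> i)" "(u', v) \<in> edges K (\<sigma> j)"
    by (auto simp: edge_S_iff)
  note ij = 14(1,2)[THEN \<sigma>(1)] 14(3)[folded neighbours_\<sigma>[OF 14(1,2)]]
  note h = head_S[OF e(2) 14(1)] head_S[OF e(3) 14(1)] head_S[OF e(1) 14(2)] head_S[OF e(2) 14(2)]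
  have "head_len K (\<sigma> i) v = head_len K (\<sigma> i) u' \<and> commute_at ((edges K (\<sigma> i))\<inverse>) ((edges K (\<sigma> j))\<inverse>) v"
    by (rule in1[OF ij e(4,5)]) (use 14(6) in \<open>simp add: edge_label_def h\<close>)
  then show ?case unfolding edge_label_def h converse_edges_S[OF 14(1)] converse_edges_S[OF 14(2)]
    using e(2) closed[OF 14(1)] closed[OF 14(2)] by (auto intro: commute_at_restrict)
next
  case (15 i j u v v')
  then have e: "u \<in> C" "v \<in> C" "v' \<in> C" "(u, v) \<in> edges K (\<sigma> i)" "(u, v') \<in> edges K (\<sigma> j)"
    by (auto simp: edge_S_iff)
  note ij = 15(1,2)[THEN \<sigma>(1)] 15(3)[folded neighbours_\<sigma>[OF 15(1,2)]]
  note h = head_S[OF e(1) 15(1)] head_S[OF e(3) 15(1)] head_S[OF e(1) 15(2)] head_S[OF e(2) 15(2)]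
  have "remotely_commute_at (edges K (\<sigma> i)) (edges K (\<sigma> j)) u"
    by (rule out11[OF ij e(4,5)]) (use 15(6,7) in \<open>simp_all add: edge_label_def h\<close>)
  then show ?case unfolding edges_S[OF 15(1)] edges_S[OF 15(2)]
    using e(1) closed[OF 15(1)] closed[OF 15(2)] by (auto intro: remotely_commute_at_restrict)
next
  case (16 i j u v u')
  then have e: "u \<in> C" "v \<in> C" "u' \<in> C" "(u, v) \<in> edges K (\<sigma> i)" "(u', v) \<in> edges K (\<sigma> j)"
    by (auto simp: edge_S_iff)
  note ij = 16(1,2)[THEN \<sigma>(1)] 16(3)[folded neighbours_\<sigma>[OF 16(1,2)]]
  note h = head_S[OF e(2) 16(1)] head_S[OF e(3) 16(1)] head_S[OF e(1) 16(2)] head_S[OF e(2) 16(2)]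
  have "remotely_commute_at ((edges K (\<sigma> i))\<inverse>) ((edges K (\<sigma> j))\<inverse>) v"
    by (rule in00[OF ij e(4,5)]) (use 16(6,7) in \<open>simp_all add: edge_label_def h\<close>)
  then show ?case unfolding converse_edges_S[OF 16(1)] converse_edges_S[OF 16(2)]
    using e(2) closed[OF 16(1)] closed[OF 16(2)] by (auto intro: remotely_commute_at_restrict)
next
  case (17 i j P Q u)
  note ij = 17(1,2)[THEN \<sigma>(1)] \<sigma>_neq[OF 17(1-3)] 17(4)[folded neighbours_\<sigma>[OF 17(1,2)]]
  obtain P' where P: "P = P' \<inter> C \<times> C" "P' \<in> {edges K (\<sigma> i), (edges K (\<sigma> i))\<inverse>}"
    using 17(5) unfolding converse_edges_S[OF 17(1)] edges_S[OF 17(1)] by blast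
  obtain Q' where Q: "Q = Q' \<inter> C \<times> C" "Q' \<in> {edges K (\<sigma> j), (edges K (\<sigma> j))\<inverse>}"
    using 17(6) unfolding converse_edges_S[OF 17(2)] edges_S[OF 17(2)] by blast
  have "commute_at P' Q' u" by (rule far_commute[OF ij P(2) Q(2)]) (use P Q 17(7,8) in auto)
  moreover have "u \<in> C" using 17(7) P by auto
  ultimately show ?case unfolding P(1) Q(1)
    by (rule commute_at_restrict) (use P(2) Q(2) closed[OF 17(1)] closed[OF 17(2)] in blast)+
qed

end

section \<open>Uniqueness of sources and sinks\<close>

text \<open>Newman's lemma: termination upgrades local confluence to confluence.\<close>

lemma newman:
  assumes wf: "wf (R\<inverse>)"
    and lc: "\<And>a b c. (a, b) \<in> R \<Longrightarrow> (a, c) \<in> R \<Longrightarrow> \<exists>d. (b, d) \<in> R\<^sup>* \<and> (c, d) \<in> R\<^sup>*"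
    and "(a, b) \<in> R\<^sup>*" "(a, c) \<in> R\<^sup>*"
  shows "\<exists>d. (b, d) \<in> R\<^sup>* \<and> (c, d) \<in> R\<^sup>*"
  using wf assms(3,4)
proof (induction a arbitrary: b c rule: wf_induct_rule)
  case (less a)
  show ?case
  proof (cases "a = b \<or> a = c")
    case True
    then show ?thesis using less.prems by blast
  next
    case False
    then obtain b1 c1 where 1: "(a, b1) \<in> R" "(b1, b) \<in> R\<^sup>*" "(a, c1) \<in> R" "(c1, c) \<in> R\<^sup>*"
      using less.prems by (meson converse_rtranclE)
    then obtain d where d: "(b1, d) \<in> R\<^sup>*" "(c1, d) \<in> R\<^sup>*" using lc by blast
    obtain e where e: "(b, e) \<in> R\<^sup>*" "(d, e) \<in> R\<^sup>*" using less.IH 1 d by blast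
    then obtain f where "(e, f) \<in> R\<^sup>*" "(c, f) \<in> R\<^sup>*"
      using less.IH[of c1 e c] 1 d by (meson converseI rtrancl_trans)
    then show ?thesis using e by (meson rtrancl_trans)
  qed
qed

text \<open>Confluence gives any two linked vertices a common descendant, and a normal form is its
  own only descendant. With \<open>R\<close> the edge relation this yields unique sinks, with its
  converse unique sources.\<close>

lemma unique_normal_form:
  assumes wf: "wf (R\<inverse>)"
    and lc: "\<And>a b c. (a, b) \<in> R \<Longrightarrow> (a, c) \<in> R \<Longrightarrow> \<exists>d. (b, d) \<in> R\<^sup>* \<and> (c, d) \<in> R\<^sup>*"
    and "(u, v) \<in> (R \<union> R\<inverse>)\<^sup>*" "u \<notin> Domain R" "v \<notin> Domain R"
  shows "u = v"
proof -
  have "\<exists>d. (u, d) \<in> R\<^sup>* \<and> (v, d) \<in> R\<^sup>*"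
    using assms(3)
  proof induction
    case (step y z)
    then obtain d where d: "(u, d) \<in> R\<^sup>*" "(y, d) \<in> R\<^sup>*" by blast
    show ?case
    proof (cases "(y, z) \<in> R")
      case True
      then have "\<exists>e. (d, e) \<in> R\<^sup>* \<and> (z, e) \<in> R\<^sup>*"
        by (intro newman[OF wf _ d(2)]) (use lc in auto)
      then obtain e where "(d, e) \<in> R\<^sup>*" "(z, e) \<in> R\<^sup>*" by blast
      then show ?thesis using d by (meson rtrancl_trans)
    next
      case False
      then show ?thesis using step d by (meson UnE converseD converse_rtrancl_into_rtrancl)
    qed
  qed blast
  then show ?thesis using assms(4,5) by (metis DomainI converse_rtranclE)
qed

lemma normal_form_exists:
  assumes "wf (R\<inverse>)"
  shows "\<exists>v. (u, v) \<in> R\<^sup>* \<and> v \<notin> Domain R"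
  using assms
proof (induction u rule: wf_induct_rule)
  case (less u)
  show ?case
  proof (cases "u \<in> Domain R")
    case True
    then show ?thesis using less by (meson DomainE converseI converse_rtrancl_into_rtrancl)
  qed blast
qed

section \<open>Termination and confluence of crystal graphs\<close>

context A_precrystal
begin

definition E :: "'v rel" where "E = (\<Union>i. edges K i)"

lemma EI: "(u, v) \<in> edges K i \<Longrightarrow> (u, v) \<in> E"
  by (auto simp: E_def)

lemma E_verts: "(u, v) \<in> E \<Longrightarrow> u \<in> verts K \<and> v \<in> verts K"
  using edges_in_verts by (auto simp: E_def)

lemma finite_E: "finite E"
proof -
  have "E \<subseteq> verts K \<times> verts K" using E_verts by auto
  then show ?thesis using finite_verts by (simp add: finite_subset)
qed

text \<open>The coefficients below are those of the sum of the positive coroots.\<close>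

lemma acyclic_E: "acyclic E"
proof -
  let ?W = "\<lambda>v. \<Sum>j=1..n. (int j * (int n + 1 - int j)) * wt j v"
  have step: "?W v < ?W u" if uv: "(u, v) \<in> E" for u v
  proof -
    obtain i where e: "(u, v) \<in> edges K i" using uv by (auto simp: E_def)
    then have "i \<in> {1..n}" by (rule edge_colour)
    \<comment> \<open>Second differences of \<open>j * (n + 1 - j)\<close> are -2, so each edge
      lowers \<open>?W\<close> by 2.\<close>
    then show ?thesis using sum_wt_step[OF e, of "\<lambda>j. int j * (int n + 1 - int j)"]
      by (simp add: algebra_simps of_nat_diff)
  qed
  have "?W v < ?W u" if "(u, v) \<in> E\<^sup>+" for u v
    using that by (induction rule: trancl_induct) (use step in fastforce)+
  then show ?thesis unfolding acyclic_def by fastforce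
qed

lemma wf_E: "wf E" "wf (E\<inverse>)"
  using finite_acyclic_wf finite_acyclic_wf_converse finite_E acyclic_E by auto

lemma commute_at_E:
  assumes "commute_at P Q u" "P \<subseteq> R" "Q \<subseteq> R" "(u, v) \<in> P" "(u, w) \<in> Q" "single_valued P" "single_valued Q"
  shows "\<exists>z. (v, z) \<in> R\<^sup>* \<and> (w, z) \<in> R\<^sup>*"
proof -
  obtain z where "(v, z) \<in> Q" "(w, z) \<in> P"
    using assms(1,4-) unfolding commute_at_def by (auto dest: single_valuedD)
  then show ?thesis using assms(2,3) by blast
qed

lemma remotely_commute_at_E:
  assumes "remotely_commute_at P Q u" "P \<subseteq> R" "Q \<subseteq> R" "(u, v) \<in> P" "(u, w) \<in> Q"
    "single_valued P" "single_valued Q"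
  shows "\<exists>z. (v, z) \<in> R\<^sup>* \<and> (w, z) \<in> R\<^sup>*"
proof -
  obtain z where "(v, z) \<in> Q O Q O P" "(w, z) \<in> P O P O Q"
    using assms(1,4-) unfolding remotely_commute_at_def by (auto dest: single_valuedD)
  moreover have "R O R O R \<subseteq> R\<^sup>*"
    by (meson r_into_rtrancl relcomp.cases rtrancl_into_rtrancl subrelI)
  then have "Q O Q O P \<subseteq> R\<^sup>*" "P O P O Q \<subseteq> R\<^sup>*"
    using assms(2,3) by (meson order_trans relcomp_mono)+
  ultimately show ?thesis by blast
qed

text \<open>For neighbouring colours the labels of the two edges decide: if one of them is 0 the
  operators commute at \<open>u\<close>, if both are 1 they commute remotely. Either way the
  branches meet again.\<close>

lemma confluent_out:
  assumes "(u, v) \<in> E" "(u, w) \<in> E"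
  shows "\<exists>z. (v, z) \<in> E\<^sup>* \<and> (w, z) \<in> E\<^sup>*"
proof -
  obtain i j where e: "(u, v) \<in> edges K i" "(u, w) \<in> edges K j" using assms by (auto simp: E_def)
  then have ij: "i \<in> {1..n}" "j \<in> {1..n}" using edge_colour by auto
  have s: "edges K i \<subseteq> E" "edges K j \<subseteq> E" by (auto simp: E_def)
  have comm: ?thesis if "commute_at (edges K i) (edges K j) u"
    using commute_at_E[OF that s e] single_valued_edges by blast
  have comm': ?thesis if "commute_at (edges K j) (edges K i) u"
    using commute_at_E[OF that s(2,1) e(2,1)] single_valued_edges by blast
  have rem: ?thesis if "remotely_commute_at (edges K i) (edges K j) u"
    using remotely_commute_at_E[OF that s e] single_valued_edges by blast
  consider "i = j" | "i \<noteq> j" "\<not> neighbours i j" | (n) "neighbours i j" by blast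
  then show ?thesis
  proof cases
    case 1
    then show ?thesis using e edge_unique by blast
  next
    case 2
    then show ?thesis using far_commute[OF ij 2, of "edges K i" "edges K j" u] e comm by blast
  next
    case n
    note n' = neighbours_sym[OF n]
    show ?thesis
      using out0[OF ij n e] out0[OF ij(2,1) n' e(2,1)] out11[OF ij n e] comm comm' rem
        neighbour_change[OF ij n e(1)] neighbour_change[OF ij(2,1) n' e(2)] by blast
  qed
qed

lemma confluent_in:
  assumes "(v, u) \<in> E" "(w, u) \<in> E"
  shows "\<exists>z. (z, v) \<in> E\<^sup>* \<and> (z, w) \<in> E\<^sup>*"
proof -
  obtain i j where e: "(v, u) \<in> edges K i" "(w, u) \<in> edges K j" using assms by (auto simp: E_def)
  then have ij: "i \<in> {1..n}" "j \<in> {1..n}" using edge_colour by auto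
  have e': "(u, v) \<in> (edges K i)\<inverse>" "(u, w) \<in> (edges K j)\<inverse>" using e by auto
  have s: "(edges K i)\<inverse> \<subseteq> E\<inverse>" "(edges K j)\<inverse> \<subseteq> E\<inverse>" by (auto simp: E_def)
  have r: ?thesis if "\<exists>z. (v, z) \<in> (E\<inverse>)\<^sup>* \<and> (w, z) \<in> (E\<inverse>)\<^sup>*"
    using that by (simp add: rtrancl_converse)
  have comm: ?thesis if "commute_at ((edges K i)\<inverse>) ((edges K j)\<inverse>) u"
    using commute_at_E[OF that s e'] single_valued_converse_edges r by blast
  have comm': ?thesis if "commute_at ((edges K j)\<inverse>) ((edges K i)\<inverse>) u"
    using commute_at_E[OF that s(2,1) e'(2,1)] single_valued_converse_edges r by blast
  have rem: ?thesis if "remotely_commute_at ((edges K i)\<inverse>) ((edges K j)\<inverse>) u"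
    using remotely_commute_at_E[OF that s e'] single_valued_converse_edges r by blast
  consider "i = j" | "i \<noteq> j" "\<not> neighbours i j" | (n) "neighbours i j" by blast
  then show ?thesis
  proof cases
    case 1
    then show ?thesis using e edge_unique' by blast
  next
    case 2
    then show ?thesis
      using far_commute[OF ij 2, of "(edges K i)\<inverse>" "(edges K j)\<inverse>" u] e comm by blast
  next
    case n
    note n' = neighbours_sym[OF n]
    show ?thesis
      using in1[OF ij n e] in1[OF ij(2,1) n' e(2,1)] in00[OF ij n e] comm comm' rem
        neighbour_change[OF ij n e(1)] neighbour_change[OF ij(2,1) n' e(2)] by blast
  qed
qed

lemma Domain_E: "u \<notin> Domain E \<longleftrightarrow> (\<forall>i\<in>{1..n}. head_len K i u = 0)"
proof
  assume "\<forall>i\<in>{1..n}. head_len K i u = 0"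
  then have "(u, v) \<notin> edges K i" for i v
    using head_pos[of i u] edge_colour[of u v i] by auto
  then show "u \<notin> Domain E" by (auto simp: E_def)
next
  assume "u \<notin> Domain E"
  then have "(u, v) \<notin> edges K i" for i v by (auto simp: E_def)
  then show "\<forall>i\<in>{1..n}. head_len K i u = 0" using head_pos by blast
qed

lemma Range_E: "v \<notin> Domain (E\<inverse>) \<longleftrightarrow> (\<forall>i\<in>{1..n}. tail_len K i v = 0)"
proof
  assume "\<forall>i\<in>{1..n}. tail_len K i v = 0"
  then have "(u, v) \<notin> edges K i" for i u
    using tail_pos[of i v] edge_colour[of u v i] by auto
  then show "v \<notin> Domain (E\<inverse>)" by (auto simp: E_def)
next
  assume "v \<notin> Domain (E\<inverse>)"
  then have "(u, v) \<notin> edges K i" for i u by (auto simp: E_def)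
  then show "\<forall>i\<in>{1..n}. tail_len K i v = 0" using tail_pos by blast
qed

lemma adjacent_E: "adjacent K 1 n \<subseteq> E \<union> E\<inverse>"
  by (auto simp: adjacent_def E_def)

lemma sink_unique:
  assumes "(u, v) \<in> (adjacent K 1 n)\<^sup>*"
    and "\<And>i. i \<in> {1..n} \<Longrightarrow> head_len K i u = 0" "\<And>i. i \<in> {1..n} \<Longrightarrow> head_len K i v = 0"
  shows "u = v"
proof -
  have "(u, v) \<in> (E \<union> E\<inverse>)\<^sup>*" using assms(1) rtrancl_mono[OF adjacent_E] by blast
  moreover have "u \<notin> Domain E" "v \<notin> Domain E" unfolding Domain_E using assms(2,3) by blast+
  ultimately show ?thesis by (intro unique_normal_form[OF wf_E(2)]) (use confluent_out in blast)+
qed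

lemma source_unique:
  assumes "(u, v) \<in> (adjacent K 1 n)\<^sup>*"
    and "\<And>i. i \<in> {1..n} \<Longrightarrow> tail_len K i u = 0" "\<And>i. i \<in> {1..n} \<Longrightarrow> tail_len K i v = 0"
  shows "u = v"
proof -
  have "(u, v) \<in> (E\<inverse> \<union> (E\<inverse>)\<inverse>)\<^sup>*" using assms(1) rtrancl_mono[OF adjacent_E] by (auto simp: Un_commute)
  moreover have "wf ((E\<inverse>)\<inverse>)" using wf_E(1) by simp
  moreover have "\<exists>d. (b, d) \<in> (E\<inverse>)\<^sup>* \<and> (c, d) \<in> (E\<inverse>)\<^sup>*" if "(a, b) \<in> E\<inverse>" "(a, c) \<in> E\<inverse>" for a b c
    using confluent_in[of b a c] that by (simp add: rtrancl_converse)
  moreover have "u \<notin> Domain (E\<inverse>)" "v \<notin> Domain (E\<inverse>)" unfolding Range_E using assms(2,3) by blast+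
  ultimately show ?thesis by (intro unique_normal_form[of "E\<inverse>" u v]) blast+
qed

end

context A_crystal
begin

sublocale A_precrystal
  by (rule A_crystal_precrystal) (rule A_crystal_axioms)

lemma source_eqI:
  assumes "s \<in> verts K" "\<And>i. i \<in> {1..n} \<Longrightarrow> tail_len K i s = 0"
  shows "source K = s"
  unfolding source_def
proof (rule the_equality)
  show "s \<in> verts K \<and> (\<forall>i. s \<notin> Range (edges K i))"
    using assms tail_pos edge_colour by (metis RangeE less_irrefl)
next
  fix s' assume s': "s' \<in> verts K \<and> (\<forall>i. s' \<notin> Range (edges K i))"
  then have "tail_len K i s' = 0" for i using tail_pos by (metis Range.intros gr0I)
  then show "s' = s" using source_unique[OF connected, of s' s] s' assms by blast
qed

lemma source: "source K \<in> verts K" "i \<in> {1..n} \<Longrightarrow> tail_len K i (source K) = 0"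
proof -
  obtain v where v: "v \<in> verts K" using verts_nonempty by blast
  obtain s where s: "(v, s) \<in> (E\<inverse>)\<^sup>*" "s \<notin> Domain (E\<inverse>)"
    using normal_form_exists[of "E\<inverse>" v] wf_E(1) by auto
  have "s \<in> verts K" using s(1) v by induction (use E_verts in auto)
  moreover have z: "\<forall>i\<in>{1..n}. tail_len K i s = 0" using s(2) unfolding Range_E .
  ultimately have "source K = s" by (intro source_eqI) auto
  with z \<open>s \<in> verts K\<close> show "source K \<in> verts K" "i \<in> {1..n} \<Longrightarrow> tail_len K i (source K) = 0"
    by auto
qed

end

section \<open>Embeddings of crystals\<close>

lemma commute_atE:
  assumes "commute_at P Q u" "(u, v) \<in> P" "(u, w) \<in> Q" "single_valued P" "single_valued Q"
  obtains z where "(v, z) \<in> Q" "(w, z) \<in> P"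
  using assms unfolding commute_at_def by (auto dest: single_valuedD)

lemma remotely_commute_atE:
  assumes "remotely_commute_at P Q u" "(u, v) \<in> P" "(u, w) \<in> Q" "single_valued P" "single_valued Q"
  obtains v1 v2 w1 w2 z where "(v, v1) \<in> Q" "(v1, v2) \<in> Q" "(v2, z) \<in> P"
    "(w, w1) \<in> P" "(w1, w2) \<in> P" "(w2, z) \<in> Q"
proof -
  obtain x z where x: "(u, x) \<in> P" "(x, z) \<in> Q O Q O P" "(u, z) \<in> Q O P O P O Q"
    using assms(1) unfolding remotely_commute_at_def by blast
  then obtain y where y: "(u, y) \<in> Q" "(y, z) \<in> P O P O Q" by blast
  have "(v, z) \<in> Q O Q O P" "(w, z) \<in> P O P O Q"
    using x y single_valuedD[OF assms(4) assms(2) x(1)] single_valuedD[OF assms(5) assms(3) y(1)] by simp_all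
  then show thesis using that by blast
qed

locale embedding = L: A_crystal n L + K: A_precrystal n K
  for n :: nat and L :: "'u crystal_graph" and K :: "'v crystal_graph" +
  fixes k0 :: 'v
  assumes tail_k0: "i \<in> {1..n} \<Longrightarrow> tail_len K i k0 = 0"
    and head_le: "i \<in> {1..n} \<Longrightarrow> head_len L i (source L) \<le> head_len K i k0"
begin

abbreviation "s \<equiv> source L"

text \<open>The prospective graph of the embedding: the same colour sequence is followed from
  \<open>s\<close> and from \<open>k0\<close>. That the result depends only on the vertex reached,
  and not on the sequence, is what has to be proved.\<close>

inductive G :: "'u \<Rightarrow> 'v \<Rightarrow> bool" where
  G_source: "G s k0"
| G_step: "G u u' \<Longrightarrow> (u, v) \<in> edges L i \<Longrightarrow> (u', v') \<in> edges K i \<Longrightarrow> G v v'"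

definition g :: "'u \<Rightarrow> 'v" where "g u = (THE x. G u x)"

text \<open>The invariant of the induction over the vertices of \<open>L\<close>. It records only
  tails; heads follow in \<open>head_g\<close> from the constant weight difference.\<close>

definition good :: "'u \<Rightarrow> bool" where
  "good u \<longleftrightarrow> (\<forall>x. G u x \<longleftrightarrow> x = g u) \<and> (\<forall>j\<in>{1..n}. tail_len K j (g u) = tail_len L j u)"

lemma goodI:
  assumes "\<And>x. G u x \<longleftrightarrow> x = y" "\<And>j. j \<in> {1..n} \<Longrightarrow> tail_len K j y = tail_len L j u"
  shows "good u"
  using assms by (auto simp: good_def g_def)

lemma good_G: "good u \<Longrightarrow> G u x \<longleftrightarrow> x = g u"
  by (simp add: good_def)

lemma tail_g: "good u \<Longrightarrow> j \<in> {1..n} \<Longrightarrow> tail_len K j (g u) = tail_len L j u"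
  by (simp add: good_def)

text \<open>Edges of equal colour subtract the same simple root in both graphs.\<close>

lemma wt_G: "G u u' \<Longrightarrow> j \<in> {1..n} \<Longrightarrow> K.wt j u' - L.wt j u = K.wt j k0 - L.wt j s"
proof (induction rule: G.induct)
  case (G_step u u' v i v')
  then show ?case using K.wt_step[of u' v' i j] L.wt_step[of u v i j] by simp
qed simp

lemma head_g:
  assumes "good u" "j \<in> {1..n}"
  shows "head_len K j (g u) + head_len L j s = head_len L j u + head_len K j k0"
  using wt_G[of u "g u" j] good_G[OF assms(1)] tail_g[OF assms] L.source(2)[OF assms(2)] tail_k0[OF assms(2)] assms(2)
  by (simp add: K.wt_def L.wt_def)

text \<open>By \<open>head_le\<close> the head lengths at \<open>g u\<close> are at least those at
  \<open>u\<close>, so an edge leaving \<open>u\<close> always has a partner in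
  \<open>K\<close>.\<close>

lemma edge_g:
  assumes "good u" "good v" "(u, v) \<in> edges L i"
  shows "(g u, g v) \<in> edges K i"
proof -
  have i: "i \<in> {1..n}" using L.edge_colour assms(3) .
  have "0 < head_len K i (g u)"
    using head_g[OF assms(1) i] head_le[OF i] L.head_step[OF assms(3)] by simp
  then obtain x where x: "(g u, x) \<in> edges K i" using K.head_pos by blast
  then have "G v x" using G_step good_G assms by blast
  then show ?thesis using x good_G[OF assms(2)] by simp
qed

lemma out_edge_g:
  assumes "good u" "(u, v) \<in> edges L i"
  obtains x where "(g u, x) \<in> edges K i" "G v x"
proof -
  have i: "i \<in> {1..n}" using L.edge_colour assms(2) .
  have "0 < head_len K i (g u)"
    using head_g[OF assms(1) i] head_le[OF i] L.head_step[OF assms(2)] by simp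
  then obtain x where x: "(g u, x) \<in> edges K i" using K.head_pos by blast
  then have "G v x" using G_step good_G assms by blast
  with x show thesis using that by blast
qed

text \<open>Carries labels from the last vertex \<open>v\<close> of an octagon to its first vertex
  \<open>z\<close>, where the axioms of \<open>K\<close> can be invoked. A label 0 at
  \<open>z\<close> would close a square there and force \<open>q2 = p2\<close>; the head lengths
  then contradict \<open>out0\<close> at \<open>p2\<close>.\<close>

lemma remote_labels:
  assumes ij: "i \<in> {1..n}" "j \<in> {1..n}" "neighbours i j"
    and p: "(z, p1) \<in> edges L i" "(p1, p2) \<in> edges L j" "(p2, u) \<in> edges L j" "(u, v) \<in> edges L i"
    and q: "(z, q1) \<in> edges L j" "(q1, q2) \<in> edges L i" "(q2, w) \<in> edges L i" "(w, v) \<in> edges L j"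
    and l: "head_len L j v = head_len L j u" "head_len L i v = head_len L i w"
  shows "head_len L i q1 = Suc (head_len L i z)"
proof (rule ccontr)
  note ji = ij(2,1) neighbours_sym[OF ij(3)]
  note nc = L.neighbour_change[OF ji]
  assume "head_len L i q1 \<noteq> Suc (head_len L i z)"
  then have z: "head_len L i q1 = head_len L i z" using nc[OF q(1)] by auto
  from L.out0[OF ji q(1) p(1) z] have c: "head_len L j p1 = Suc (head_len L j z)"
    "commute_at (edges L j) (edges L i) z" by auto
  obtain y where "(q1, y) \<in> edges L i" "(p1, y) \<in> edges L j"
    using commute_atE[OF c(2) q(1) p(1)] L.single_valued_edges by blast
  then have e: "q2 = p2" using L.edge_unique q(2) p(2) by metis
  have h: "head_len L i u = head_len L i p2"
    using L.head_step[OF q(2)] L.head_step[OF q(3)] L.head_step[OF p(4)] l(2) e by simp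
  have "head_len L j w = Suc (head_len L j p2)" using L.out0[OF ji p(3) q(3)[unfolded e] h] by simp
  then show False using L.head_step[OF q(4)] L.head_step[OF p(3)] l(1) by simp
qed

section \<open>Induction step of the embedding at a vertex \<open>v\<close>\<close>

context
  fixes v assumes IH: "\<And>t. (t, v) \<in> L.E\<^sup>+ \<Longrightarrow> good t"
begin

lemma good_pred: "(t, v) \<in> edges L i \<Longrightarrow> good t"
  using IH L.EI by blast

lemma anc: "(t, v) \<in> edges L i \<Longrightarrow> (t, v) \<in> L.E\<^sup>+" "(t, r) \<in> edges L i \<Longrightarrow> (r, v) \<in> L.E\<^sup>+ \<Longrightarrow> (t, v) \<in> L.E\<^sup>+"
  using L.EI by (auto intro: trancl_into_trancl2)

text \<open>Different edges into \<open>v\<close> must prescribe the same image. The square of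
  \<open>L\<close> that ends in \<open>v\<close> starts at some \<open>z\<close>; its two edges
  leaving \<open>z\<close> are mapped to \<open>K\<close>, and there the square is closed again. The
  next two lemmas follow the same plan.\<close>

lemma preds_agree_far:
  assumes ij: "i \<in> {1..n}" "j \<in> {1..n}" "i \<noteq> j" "\<not> neighbours i j"
    and e: "(u, v) \<in> edges L i" "(w, v) \<in> edges L j" "(g u, v') \<in> edges K i"
  shows "(g w, v') \<in> edges K j"
proof -
  have "commute_at ((edges L i)\<inverse>) ((edges L j)\<inverse>) v" by (rule L.far_commute[OF ij]) (use e in auto)
  then obtain z where z: "(z, u) \<in> edges L j" "(z, w) \<in> edges L i"
    by (rule commute_atE) (use e L.single_valued_converse_edges in auto)
  note gd = good_pred[OF e(1)] good_pred[OF e(2)] IH[OF anc(2)[OF z(1) anc(1)[OF e(1)]]]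
  have z': "(g z, g u) \<in> edges K j" "(g z, g w) \<in> edges K i" using edge_g z gd by auto
  have "commute_at (edges K i) (edges K j) (g z)" by (rule K.far_commute[OF ij]) (use z' in auto)
  then obtain y where "(g w, y) \<in> edges K j" "(g u, y) \<in> edges K i"
    by (rule commute_atE) (use z' K.single_valued_edges in auto)
  then show ?thesis using K.edge_unique e(3) by metis
qed

lemma preds_agree_commute:
  assumes ij: "i \<in> {1..n}" "j \<in> {1..n}" "neighbours i j"
    and e: "(u, v) \<in> edges L i" "(w, v) \<in> edges L j"
    and l: "head_len L j v = Suc (head_len L j u)"
  shows "\<exists>y. (g u, y) \<in> edges K i \<and> (g w, y) \<in> edges K j"
proof -
  note ji = ij(2,1) neighbours_sym[OF ij(3)]
  from L.in1[OF ij e l] have c: "head_len L i v = head_len L i w"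
    "commute_at ((edges L i)\<inverse>) ((edges L j)\<inverse>) v" by auto
  obtain z where z: "(z, u) \<in> edges L j" "(z, w) \<in> edges L i"
    using c(2) by (rule commute_atE) (use e L.single_valued_converse_edges in auto)
  note gd = good_pred[OF e(1)] good_pred[OF e(2)] IH[OF anc(2)[OF z(1) anc(1)[OF e(1)]]]
  have z': "(g z, g u) \<in> edges K j" "(g z, g w) \<in> edges K i" using edge_g z gd by auto
  \<comment> \<open>Both edges of colour \<open>j\<close> in the square have the same label, so the
    label 0 at \<open>v\<close> passes to \<open>z\<close>, and \<open>out0\<close> applies after
    transport to \<open>K\<close>.\<close>
  have "head_len L i u = head_len L i z"
    using c(1) L.head_step[OF z(2)] L.head_step[OF e(1)] by simp
  then have "head_len K i (g u) = head_len K i (g z)" using head_g[OF gd(1) ij(1)] head_g[OF gd(3) ij(1)] by simp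
  then have "commute_at (edges K j) (edges K i) (g z)" using K.out0[OF ji z'] by simp
  then obtain y where "(g u, y) \<in> edges K i" "(g w, y) \<in> edges K j"
    by (rule commute_atE) (use z' K.single_valued_edges in auto)
  then show ?thesis by blast
qed

lemma preds_agree_remote:
  assumes ij: "i \<in> {1..n}" "j \<in> {1..n}" "neighbours i j"
    and e: "(u, v) \<in> edges L i" "(w, v) \<in> edges L j"
    and l: "head_len L j v = head_len L j u" "head_len L i v = head_len L i w"
  shows "\<exists>y. (g u, y) \<in> edges K i \<and> (g w, y) \<in> edges K j"
proof -
  note ji = ij(2,1) neighbours_sym[OF ij(3)]
  have "remotely_commute_at ((edges L i)\<inverse>) ((edges L j)\<inverse>) v" by (rule L.in00[OF ij e l])
  then obtain p2 p1 q2 q1 z where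
    p: "(p2, u) \<in> edges L j" "(p1, p2) \<in> edges L j" "(z, p1) \<in> edges L i" and
    q: "(q2, w) \<in> edges L i" "(q1, q2) \<in> edges L i" "(z, q1) \<in> edges L j"
    by (rule remotely_commute_atE) (use e L.single_valued_converse_edges in auto)
  have l1: "head_len L i q1 = Suc (head_len L i z)"
    by (rule remote_labels[OF ij p(3,2,1) e(1) q(3,2,1) e(2) l])
  have l2: "head_len L j p1 = Suc (head_len L j z)"
    by (rule remote_labels[OF ji q(3,2,1) e(2) p(3,2,1) e(1) l(2,1)])
  have a: "(u, v) \<in> L.E\<^sup>+" "(w, v) \<in> L.E\<^sup>+" "(p2, v) \<in> L.E\<^sup>+" "(p1, v) \<in> L.E\<^sup>+"
    "(q2, v) \<in> L.E\<^sup>+" "(q1, v) \<in> L.E\<^sup>+" "(z, v) \<in> L.E\<^sup>+"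
    using anc e p q by metis+
  note gd = a[THEN IH]
  have p': "(g p2, g u) \<in> edges K j" "(g p1, g p2) \<in> edges K j" "(g z, g p1) \<in> edges K i" and
    q': "(g q2, g w) \<in> edges K i" "(g q1, g q2) \<in> edges K i" "(g z, g q1) \<in> edges K j"
    using edge_g gd p q by auto
  have m: "head_len K j (g p1) = Suc (head_len K j (g z))" "head_len K i (g q1) = Suc (head_len K i (g z))"
    using l1 l2 head_g[OF gd(4) ij(2)] head_g[OF gd(7) ij(2)] head_g[OF gd(6) ij(1)] head_g[OF gd(7) ij(1)] by auto
  have "remotely_commute_at (edges K i) (edges K j) (g z)" by (rule K.out11[OF ij p'(3) q'(3) m])
  then obtain v1 v2 w1 w2 y where y: "(g p1, v1) \<in> edges K j" "(v1, v2) \<in> edges K j" "(v2, y) \<in> edges K i"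
    "(g q1, w1) \<in> edges K i" "(w1, w2) \<in> edges K i" "(w2, y) \<in> edges K j"
    by (rule remotely_commute_atE) (use p' q' K.single_valued_edges in auto)
  \<comment> \<open>Uniqueness of edges identifies the octagon in \<open>K\<close>, step by step,
    with the image of the one in \<open>L\<close>, up to its last vertex \<open>y\<close>.\<close>
  have "v1 = g p2" "w1 = g q2" using y p' q' K.edge_unique by metis+
  then have "v2 = g u" "w2 = g w" using y p' q' K.edge_unique by metis+
  then show ?thesis using y by blast
qed

lemma preds_agree:
  assumes e: "(u, v) \<in> edges L i" "(w, v) \<in> edges L j" "(g u, v') \<in> edges K i"
  shows "(g w, v') \<in> edges K j"
proof -
  have ij: "i \<in> {1..n}" "j \<in> {1..n}" using L.edge_colour e by blast+
  consider "i = j" | (far) "i \<noteq> j" "\<not> neighbours i j" | (n) "neighbours i j" by blast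
  then show ?thesis
  proof cases
    case 1
    then show ?thesis using e L.edge_unique' by metis
  next
    case far
    then show ?thesis using preds_agree_far ij e by blast
  next
    case n
    note n' = neighbours_sym[OF n]
    have "\<exists>y. (g u, y) \<in> edges K i \<and> (g w, y) \<in> edges K j"
      using L.neighbour_change[OF ij n e(1)] L.neighbour_change[OF ij(2,1) n' e(2)]
        preds_agree_commute[OF ij n e(1,2)] preds_agree_commute[OF ij(2,1) n' e(2,1)]
        preds_agree_remote[OF ij n e(1,2)] by blast
    then show ?thesis using K.edge_unique e(3) by metis
  qed
qed

text \<open>For neighbouring colours, a \<open>j\<close>-predecessor of \<open>v'\<close> would, by
  \<open>in1\<close>, span a square of \<open>K\<close> starting at the image of the
  \<open>j\<close>-predecessor \<open>t\<close> of \<open>u\<close>. A label 0 found there carries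
  back to \<open>L\<close>, where \<open>out0\<close> at \<open>t\<close> closes a square at
  \<open>v\<close> and so gives \<open>v\<close> a \<open>j\<close>-predecessor.\<close>

lemma tail_zero:
  assumes e: "(u, v) \<in> edges L i" "(g u, v') \<in> edges K i" and j: "j \<in> {1..n}" "tail_len L j v = 0"
  shows "tail_len K j v' = 0"
proof (rule ccontr)
  assume "\<not> ?thesis"
  then obtain y where y: "(y, v') \<in> edges K j" using K.tail_pos by blast
  have i: "i \<in> {1..n}" using L.edge_colour e by blast
  note gu = good_pred[OF e(1)]
  consider "i = j" | (far) "i \<noteq> j" "\<not> neighbours i j" | (n) "neighbours i j" by blast
  then show False
  proof cases
    case 1
    then show False using L.tail_step[OF e(1)] j by simp
  next
    case far
    then show False
      using L.far_change[OF i j(1) far e(1)] K.far_change[OF i j(1) far e(2)] j tail_g[OF gu j(1)]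
        K.tail_step[OF y] by simp
  next
    case n
    note n' = neighbours_sym[OF n]
    have t: "tail_len L j u = 1" "head_len K j v' = Suc (head_len K j (g u))"
      using L.neighbour_change[OF i j(1) n e(1)] K.neighbour_change[OF i j(1) n e(2)]
        j(2) tail_g[OF gu j(1)] K.tail_step[OF y] by auto
    obtain t where tu: "(t, u) \<in> edges L j" using t(1) L.tail_pos by (metis zero_less_one)
    have gt: "good t" using IH anc tu e(1) by metis
    have c: "head_len K i v' = head_len K i y" "commute_at ((edges K i)\<inverse>) ((edges K j)\<inverse>) v'"
      using K.in1[OF i j(1) n e(2) y t(2)] by auto
    obtain z where z: "(z, g u) \<in> edges K j" "(z, y) \<in> edges K i"
      using c(2) by (rule commute_atE) (use e y K.single_valued_converse_edges in auto)
    have "z = g t" using z(1) edge_g[OF gt gu tu] K.edge_unique' by metis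
    then have "head_len K i (g u) = head_len K i (g t)"
      using c(1) K.head_step[OF z(2)] K.head_step[OF e(2)] by simp
    then have h: "head_len L i u = head_len L i t" using head_g[OF gu i] head_g[OF gt i] by simp
    then have "0 < head_len L i t" using L.head_step[OF e(1)] by simp
    then obtain r where r: "(t, r) \<in> edges L i" using L.head_pos by blast
    have "commute_at (edges L j) (edges L i) t" using L.out0[OF j(1) i n' tu r h] by simp
    then obtain x where "(u, x) \<in> edges L i" "(r, x) \<in> edges L j"
      by (rule commute_atE) (use tu r L.single_valued_edges in auto)
    then have "(r, v) \<in> edges L j" using L.edge_unique[OF e(1)] by metis
    then show False using L.tail_step j(2) by fastforce
  qed
qed

lemma good_step:
  assumes v: "v \<in> verts L"
  shows "good v"
proof (cases "\<exists>u i. (u, v) \<in> edges L i")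
  case False
  then have "tail_len L i v = 0" for i using L.tail_pos by blast
  then have s: "s = v" using v L.source_eqI by blast
  have "G v x \<longleftrightarrow> x = k0" for x
    using False by (subst G.simps) (auto simp: s)
  then show ?thesis
    by (rule goodI) (use L.source(2) tail_k0 s in auto)
next
  case True
  then obtain u i where u: "(u, v) \<in> edges L i" by blast
  obtain v' where v': "(g u, v') \<in> edges K i" "G v v'" using out_edge_g[OF good_pred[OF u] u] by blast
  have "G v x \<longleftrightarrow> x = v'" for x
  proof
    assume "G v x"
    then show "x = v'"
    proof (cases rule: G.cases)
      case G_source
      then show ?thesis using L.source(2) u L.tail_step L.edge_colour by fastforce
    next
      case (G_step w w' j)
      then have "w' = g w" using good_G good_pred by blast
      then show ?thesis using preds_agree[OF u G_step(2) v'(1)] G_step(3) K.edge_unique by metis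
    qed
  qed (use v' in simp)
  \<comment> \<open>If \<open>v\<close> has a \<open>j\<close>-predecessor \<open>w\<close>, then
    \<open>g w\<close> precedes \<open>v'\<close> because predecessors agree, and its tail is known;
    otherwise \<open>tail_zero\<close> applies.\<close>
  moreover have "tail_len K j v' = tail_len L j v" if j: "j \<in> {1..n}" for j
  proof (cases "tail_len L j v = 0")
    case True
    then show ?thesis using tail_zero[OF u v'(1) j] by simp
  next
    case False
    then obtain w where w: "(w, v) \<in> edges L j" using L.tail_pos by blast
    then show ?thesis using preds_agree[OF u w v'(1)] L.tail_step K.tail_step tail_g[OF good_pred[OF w] j] by metis
  qed
  ultimately show ?thesis by (rule goodI)
qed

end

lemma good: "v \<in> verts L \<Longrightarrow> good v"
\<comment> \<open>The induction runs over all ancestors and not just predecessors, because an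
  octagon ending in \<open>v\<close> begins four edges earlier.\<close>
proof (induction v rule: wf_induct_rule[OF wf_trancl[OF L.wf_E(1)]])
  case (1 v)
  have "good t" if "(t, v) \<in> L.E\<^sup>+" for t
  proof -
    have "t \<in> verts L" using that by (induction rule: converse_trancl_induct) (use L.E_verts in auto)
    then show ?thesis using 1 that by blast
  qed
  then show ?case using good_step 1 by blast
qed

theorem embedding:
  "\<exists>g. g s = k0
    \<and> (\<forall>i u v. (u, v) \<in> edges L i \<longrightarrow> (g u, g v) \<in> edges K i)
    \<and> (\<forall>u\<in>verts L. \<forall>i\<in>{1..n}. tail_len K i (g u) = tail_len L i u
        \<and> head_len K i (g u) + head_len L i s = head_len L i u + head_len K i k0)"
proof (intro exI[of _ g] conjI allI impI ballI)
  show "g s = k0" using good[OF L.source(1)] good_G G_source by metis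
next
  fix i u v assume "(u, v) \<in> edges L i"
  then show "(g u, g v) \<in> edges K i" using edge_g good L.edges_in_verts by blast
qed (use good tail_g head_g in blast)+

end

section \<open>Words\<close>

text \<open>
  The signature rule: a letter \<open>i + 1\<close> is matched with an earlier letter \<open>i\<close>, and \<open>eps\<close> and \<open>phi\<close> count
  the unmatched letters \<open>i + 1\<close> and \<open>i\<close>. The operators \<open>eop\<close> and \<open>fop\<close> act as the identity where the
  crystal operators are undefined. Letters and colours are integers, so that \<open>x \<mapsto> - x\<close> reverses the
  alphabet.
\<close>

definition phi1 :: "int \<Rightarrow> int \<Rightarrow> nat" where "phi1 i x = (if x = i then 1 else 0)"
definition eps1 :: "int \<Rightarrow> int \<Rightarrow> nat" where "eps1 i x = (if x = i + 1 then 1 else 0)"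

text \<open>Truncated subtraction performs the matching: a leading \<open>i\<close> cancels one
  unmatched \<open>i + 1\<close> of the rest, if there is any.\<close>

fun eps :: "int \<Rightarrow> int list \<Rightarrow> nat" where
  "eps i [] = 0"
| "eps i (x # w) = (eps i w - phi1 i x) + eps1 i x"

fun phi :: "int \<Rightarrow> int list \<Rightarrow> nat" where
  "phi i [] = 0"
| "phi i (x # w) = phi i w + (phi1 i x - eps i w)"

fun eop :: "int \<Rightarrow> int list \<Rightarrow> int list" where
  "eop i [] = []"
| "eop i (x # w) = (if phi1 i x < eps i w then x # eop i w else if x = i + 1 then i # w else x # w)"

fun fop :: "int \<Rightarrow> int list \<Rightarrow> int list" where
  "fop i [] = []"
| "fop i (x # w) = (if x = i \<and> eps i w = 0 then (i + 1) # w else x # fop i w)"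

lemmas letter_defs = phi1_def eps1_def

lemma eop_same: "0 < eps i w \<Longrightarrow> eps i w = Suc (eps i (eop i w)) \<and> phi i (eop i w) = Suc (phi i w)
   \<and> fop i (eop i w) = w"
  by (induction w) (auto simp: letter_defs split: if_splits)

lemma fop_same: "0 < phi i w \<Longrightarrow> phi i w = Suc (phi i (fop i w)) \<and> eps i (fop i w) = Suc (eps i w)
   \<and> eop i (fop i w) = w"
  by (induction w) (auto simp: letter_defs split: if_splits)

text \<open>The tensor product rule: unmatched letters \<open>i\<close> of \<open>u\<close> cancel
  against unmatched letters \<open>i + 1\<close> of \<open>v\<close>.\<close>

lemma eps_append: "eps i (u @ v) = (eps i v - phi i u) + eps i u"
  and phi_append: "phi i (u @ v) = phi i v + (phi i u - eps i v)"
  by (induction u) (auto simp: letter_defs)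

lemma eop_undefined: "eps i w = 0 \<Longrightarrow> eop i w = w"
  by (cases w) (auto simp: letter_defs)

lemma eop_append: "eop i (u @ v) = (if phi i u < eps i v then u @ eop i v else eop i u @ v)"
  by (induction u) (auto simp: letter_defs eps_append phi_append eop_undefined)

lemma fop_append: "fop i (u @ v) = (if eps i v < phi i u then fop i u @ v else u @ fop i v)"
  by (induction u) (auto simp: letter_defs eps_append phi_append)

section \<open>Stembridge relations for raising operators on words\<close>

definition nb :: "int \<Rightarrow> int \<Rightarrow> bool" where "nb i j \<longleftrightarrow> i = j + 1 \<or> j = i + 1"

lemma eps_eop_nb: "nb i j \<Longrightarrow> 0 < eps i w \<Longrightarrow> eps j (eop i w) = eps j w \<or> eps j (eop i w) = Suc (eps j w)"
  by (induction w) (auto simp: letter_defs nb_def split: if_splits)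

lemma eps_eop_mono: "nb i j \<Longrightarrow> eps j w \<le> eps j (eop i w)"
  using eps_eop_nb[of i j w] eop_undefined[of i w] by force

definition word_wt :: "int \<Rightarrow> int list \<Rightarrow> int" where "word_wt i w = int (phi i w) - int (eps i w)"

lemma word_wt_Cons: "word_wt i (x # w) = word_wt i w + int (phi1 i x) - int (eps1 i x)"
  by (auto simp: word_wt_def letter_defs)

lemma word_wt_eop_same: "0 < eps i w \<Longrightarrow> word_wt i (eop i w) = word_wt i w + 2"
  using eop_same[of i w] by (auto simp: word_wt_def)

lemma word_wt_eop_nb: "nb i j \<Longrightarrow> 0 < eps i w \<Longrightarrow> word_wt j (eop i w) = word_wt j w - 1"
  by (induction w) (auto simp: letter_defs nb_def word_wt_Cons split: if_splits)

lemma eps_eop_convex: "nb i j \<Longrightarrow> 2 \<le> eps i w \<Longrightarrow>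
   2 * eps j (eop i w) \<le> eps j w + eps j (eop i (eop i w))"
proof (induction w)
  case (Cons x w)
  have r: "eps j (eop i w) = eps j w \<or> eps j (eop i w) = Suc (eps j w)" if "0 < eps i w"
    using eps_eop_nb that Cons.prems by blast
  have s: "eps i w = Suc (eps i (eop i w))" if "0 < eps i w" using eop_same that by blast
  show ?case
  proof (cases "phi1 i x + 2 \<le> eps i w")
    case True
    then have e: "phi1 i x < eps i w" "phi1 i x < eps i (eop i w)" using s by auto
    have "2 * eps j (eop i w) \<le> eps j w + eps j (eop i (eop i w))"
      using Cons True by auto
    then show ?thesis using e r by auto
  next
    \<comment> \<open>Here the first raising acts inside \<open>w\<close> and the second one changes
      the leading letter.\<close>
    case False
    then have e: "x = i + 1" "eps i w = Suc 0" "eps i (eop i w) = 0"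
      using Cons.prems s by (auto simp: letter_defs split: if_splits)
    show ?thesis using e r Cons.prems(1) by (auto simp: letter_defs nb_def)
  qed
qed auto

lemma nb_sym: "nb i j \<Longrightarrow> nb j i"
  unfolding nb_def by auto

text \<open>
  Excludes the one configuration in which prefixing a letter could spoil the remote commutation below.
\<close>

lemma eps_mixed: "nb i j \<Longrightarrow> 0 < eps i w \<Longrightarrow> 0 < phi j w \<Longrightarrow> eps i w = Suc (eps i (fop j w)) \<Longrightarrow>
   eps j (eop i w) = eps j w"
proof (induction w)
  case (Cons x w)
  note n = Cons.prems(1)
  consider (ww) "phi1 i x < eps i w" "\<not> (x = j \<and> eps j w = 0)"
    | (wx) "phi1 i x < eps i w" "x = j" "eps j w = 0"
    | (xw) "x = i + 1" "eps i w = 0" "\<not> (x = j \<and> eps j w = 0)"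
    | (xx) "x = i + 1" "eps i w = 0" "x = j" "eps j w = 0"
    using Cons.prems(2) by (auto simp: letter_defs split: if_splits)
  then show ?case
  proof cases
    case ww
    then have f: "0 < phi j w" using Cons.prems(3) by (auto simp: letter_defs split: if_splits)
    have "eps i w \<le> Suc (eps i (fop j w))"
      using eps_eop_nb[OF nb_sym[OF n], of "fop j w"] fop_same[OF f] by auto
    moreover have "eps i w - phi1 i x = Suc (eps i (fop j w) - phi1 i x)"
      using Cons.prems(4) ww by (simp split: if_splits)
    ultimately have "eps i w = Suc (eps i (fop j w))" using ww(1) by linarith
    then have "eps j (eop i w) = eps j w" using Cons.IH n ww f by linarith
    then show ?thesis using ww by simp
  next
    case wx
    then show ?thesis using eps_eop_nb[OF n, of w] by (auto simp: letter_defs)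
  next
    case xw
    then have False using Cons.prems(4) by (auto simp: letter_defs split: if_splits)
    then show ?thesis ..
  next
    case xx
    then show ?thesis by (simp add: letter_defs)
  qed
qed auto

lemma length_eop [simp]: "length (eop i w) = length w"
  by (induction w) auto

text \<open>The axioms for two edges ending in \<open>v\<close>, expressed by \<open>eps\<close>. If
  \<open>eps\<close> is unchanged then \<open>head_len\<close> grows along the edge, so equality
  here corresponds to edge label 1 and \<open>Suc\<close> to label 0.\<close>

definition in_axiom :: "int \<Rightarrow> int \<Rightarrow> int list \<Rightarrow> bool" where
  "in_axiom i j v \<longleftrightarrow> \<not> (eps j (eop i v) = eps j v \<and> eps i (eop j v) = eps i v) \<and>
    ((eps j (eop i v) = eps j v \<or> eps i (eop j v) = eps i v) \<longrightarrow> eop i (eop j v) = eop j (eop i v)) \<and>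
    (eps j (eop i v) = Suc (eps j v) \<and> eps i (eop j v) = Suc (eps i v) \<longrightarrow>
      eop i (eop j (eop j (eop i v))) = eop j (eop i (eop i (eop j v))))"

lemma in_axiom_sym: "in_axiom i j v \<Longrightarrow> in_axiom j i v"
  unfolding in_axiom_def by auto

text \<open>Guarantees that the last raising on a side of the octagon is defined, and that it still
  acts inside \<open>w\<close> after a letter has been prefixed as in
  \<open>in_axiom_both\<close>.\<close>

lemma in_axiom_remote_le:
  assumes n: "nb i j" and i: "0 < eps i w" and j: "0 < eps j w" and I: "in_axiom i j w"
    and r: "eps j (eop i w) = Suc (eps j w)" "eps i (eop j w) = Suc (eps i w)"
  shows "eps i w \<le> eps i (eop j (eop j (eop i w)))"
proof -
  let ?a = "eop i w" and ?b = "eop j w"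
  note ji = nb_sym[OF n]
  have a1: "eps j (eop j ?a) = eps j w" and b1: "eps i (eop i ?b) = eps i w"
    using eop_same[of j ?a] eop_same[of i ?b] r by auto
  have b2: "eps i (eop i (eop i ?b)) = eps i w - 1"
    using eop_same[of i "eop i ?b"] b1 i by auto
  have z: "eop i (eop j (eop j ?a)) = eop j (eop i (eop i ?b))" using I r by (auto simp: in_axiom_def)
  have zi: "eps i w - 1 \<le> eps i (eop i (eop j (eop j ?a)))"
    unfolding z using eps_eop_mono[OF ji, of "eop i (eop i ?b)"] b2 by simp
  have d: "0 < eps j ?a" "0 < eps j (eop j ?a)" "0 < eps i ?b" "0 < eps i (eop i ?b)"
    using i j r a1 b1 by auto
  have wa: "word_wt i (eop j (eop j ?a)) = word_wt i w"
    using word_wt_eop_nb[OF ji, of ?a] word_wt_eop_nb[OF ji, of "eop j ?a"] word_wt_eop_same[of i w] d i by auto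
  have wb: "word_wt i (eop i (eop i ?b)) = word_wt i w + 3"
    using word_wt_eop_nb[OF ji, of w] word_wt_eop_same[of i ?b] word_wt_eop_same[of i "eop i ?b"] d j by auto
  \<comment> \<open>If the last raising were the identity, the \<open>i\<close>-weights of the two
    sides of equation \<open>z\<close> would differ by at least 2.\<close>
  have "0 < eps i (eop j (eop j ?a))"
  proof (rule ccontr)
    assume "\<not> ?thesis"
    then have "word_wt i (eop i (eop j (eop j ?a))) = word_wt i w" using wa by (simp add: eop_undefined)
    moreover have "word_wt i w + 2 \<le> word_wt i (eop j (eop i (eop i ?b)))"
      using wb word_wt_eop_nb[OF ji, of "eop i (eop i ?b)"] eop_undefined[of j "eop i (eop i ?b)"] by force
    ultimately show False using z by simp
  qed
  then show ?thesis using zi eop_same[of i "eop j (eop j ?a)"] by auto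
qed

lemma in_axiom_both:
  assumes n: "nb i j" and I: "in_axiom i j w" and i: "phi1 i x < eps i w" and j: "phi1 j x < eps j w"
  shows "in_axiom i j (x # w)"
proof -
  have p: "phi1 i x < eps i (eop j w)" "phi1 j x < eps j (eop i w)"
    using eps_eop_mono[OF n, of w] eps_eop_mono[OF nb_sym[OF n], of w] i j by linarith+
  have h: "eop i (x # w) = x # eop i w" "eop j (x # w) = x # eop j w"
    "eop j (x # eop i w) = x # eop j (eop i w)" "eop i (x # eop j w) = x # eop i (eop j w)"
    using i j p by simp_all
  have e: "eps j (eop i (x # w)) = eps j (x # w) \<longleftrightarrow> eps j (eop i w) = eps j w"
    "eps i (eop j (x # w)) = eps i (x # w) \<longleftrightarrow> eps i (eop j w) = eps i w"
    "eps j (eop i (x # w)) = Suc (eps j (x # w)) \<longleftrightarrow> eps j (eop i w) = Suc (eps j w)"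
    "eps i (eop j (x # w)) = Suc (eps i (x # w)) \<longleftrightarrow> eps i (eop j w) = Suc (eps i w)"
    unfolding h eps.simps using i j p by linarith+
  show ?thesis
  proof (cases "eps j (eop i w) = Suc (eps j w) \<and> eps i (eop j w) = Suc (eps i w)")
    case False
    moreover have "eps j (eop i w) = eps j w \<or> eps j (eop i w) = Suc (eps j w)" using eps_eop_nb[OF n] i by simp
    moreover have "eps i (eop j w) = eps i w \<or> eps i (eop j w) = Suc (eps i w)"
      using eps_eop_nb[OF nb_sym[OF n]] j by simp
    ultimately have "eop i (eop j w) = eop j (eop i w)" using I unfolding in_axiom_def by blast
    then have "eop i (eop j (x # w)) = eop j (eop i (x # w))" unfolding h by (simp only:)
    then show ?thesis using I False unfolding in_axiom_def e by blast
  next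
    case True
    let ?a = "eop i w" and ?b = "eop j w"
    have i': "0 < eps i w" and j': "0 < eps j w" using i j by auto
    have a1: "eps j (eop j ?a) = eps j w" and b1: "eps i (eop i ?b) = eps i w"
      using eop_same[of j ?a] eop_same[of i ?b] True by auto
    have z: "eop i (eop j (eop j ?a)) = eop j (eop i (eop i ?b))" using I True by (auto simp: in_axiom_def)
    have ki: "phi1 i x < eps i (eop j (eop j ?a))" and kj: "phi1 j x < eps j (eop i (eop i ?b))"
      using in_axiom_remote_le[OF n i' j' I] in_axiom_remote_le[OF nb_sym[OF n] j' i' in_axiom_sym[OF I]] True i j by auto
    have "eop i (eop j (eop j (eop i (x # w)))) = x # eop i (eop j (eop j ?a))"
      "eop j (eop i (eop i (eop j (x # w)))) = x # eop j (eop i (eop i ?b))"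
      using ki kj p a1 b1 i j unfolding h by simp_all
    then have "eop i (eop j (eop j (eop i (x # w)))) = eop j (eop i (eop i (eop j (x # w))))"
      using z by (simp only:)
    then show ?thesis unfolding in_axiom_def e using True by simp
  qed
qed

text \<open>Raising by \<open>i\<close> changes the leading letter, raising by \<open>j\<close> the
  rest. If \<open>eop j w\<close> has no unmatched \<open>i + 1\<close>, the two commute directly.
  Otherwise \<open>eps_mixed\<close> applies, and when \<open>eps j w\<close> is at least 2 the
  octagon for \<open>x # w\<close> reduces to a commuting square at \<open>eop j w\<close>, which is
  supplied by \<open>I\<close>.\<close>

lemma in_axiom_mixed:
  assumes n: "nb i j" and I: "\<lbrakk>0 < eps i (eop j w); 0 < eps j (eop j w)\<rbrakk> \<Longrightarrow> in_axiom i j (eop j w)"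
    and i: "x = i + 1" "eps i w = 0" and j: "phi1 j x < eps j w"
  shows "in_axiom i j (x # w)"
proof -
  note ni = nb_sym[OF n]
  note r = eps_eop_nb[OF ni, of w]
  note s = eop_same[of j w]
  show ?thesis
  proof (cases "eps i (eop j w) = 0")
    case True
    then show ?thesis using i j s n by (auto simp: in_axiom_def letter_defs nb_def)
  next
    case False
    then have 1: "eps i (eop j w) = 1" using r i j by auto
    show ?thesis
    proof (cases "2 \<le> eps j w")
      case False
      then have "eps j w = 1" "j = i - 1" using j i n by (auto simp: nb_def letter_defs split: if_splits)
      moreover have "eps j (eop j w) = 0" using s calculation by simp
      moreover have "eps j (eop i (eop j w)) = 0"
        using eps_mixed[OF n, of "eop j w"] s 1 i calculation by simp
      moreover have "eps i (eop i (eop j w)) = 0" using eop_same[of i "eop j w"] 1 by simp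
      ultimately show ?thesis using i j s n 1 by (auto simp: in_axiom_def letter_defs nb_def)
    next
      case j2: True
      let ?y = "eop j w"
      have y: "0 < eps i ?y" "0 < phi j ?y" "0 < eps j ?y" "fop j ?y = w" using 1 j2 eop_same[of j w] by auto
      have e: "eps j (eop i ?y) = eps j ?y" using eps_mixed[OF n y(1,2)] y 1 i by simp
      have e2: "eps i (eop j ?y) = 2"
        using eps_eop_convex[OF ni, of w] eps_eop_nb[OF ni, of ?y] 1 y i j2 by auto
      have c: "eop i (eop j ?y) = eop j (eop i ?y)" using I[OF y(1,3)] e by (auto simp: in_axiom_def)
      have f: "eps i (eop i ?y) = 0" "0 < eps j (eop i ?y)" using eop_same[OF y(1)] 1 e y by simp_all
      have l: "phi1 i x = 0" "eps1 i x = 1" "phi1 i i = 1" "phi1 j i = 0"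
        "eps1 j i + phi1 j x = Suc (eps1 j x)"
        using i n by (auto simp: letter_defs nb_def)
      have A: "eop i (x # w) = i # w" "eop j (x # w) = x # ?y" using i j by (auto simp: l)
      have B: "eop i (eop j (eop j (eop i (x # w)))) = i # eop i (eop j ?y)"
        unfolding A using j2 y(3) e2 by (simp add: l)
      have C: "eop j (eop i (eop i (eop j (x # w)))) = i # eop j (eop i ?y)"
      proof -
        have "eop i (x # ?y) = x # eop i ?y" using 1 by (simp add: l)
        moreover have "eop i (x # eop i ?y) = i # eop i ?y" using f(1) i(1) by simp
        moreover have "eop j (i # eop i ?y) = i # eop j (eop i ?y)" using f(2) by (simp add: l)
        ultimately show ?thesis unfolding A by simp
      qed
      have "eps j (eop i (x # w)) = Suc (eps j (x # w))" "eps i (eop j (x # w)) = Suc (eps i (x # w))"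
        unfolding A using l i j 1 by simp_all
      then show ?thesis unfolding in_axiom_def B C using c by simp
    qed
  qed
qed

lemma in_axiom: "nb i j \<Longrightarrow> 0 < eps i v \<Longrightarrow> 0 < eps j v \<Longrightarrow> in_axiom i j v"
\<comment> \<open>The mixed case needs the claim for \<open>eop j w\<close>, which need not be a
  suffix of \<open>v\<close> but is shorter.\<close>
proof (induction v rule: length_induct)
  case (1 v)
  show ?case
  proof (cases v)
    case (Cons x w)
    have IH: "in_axiom i j u" if "length u = length w" "0 < eps i u" "0 < eps j u" for u
      using 1 Cons that by auto
    consider (both) "phi1 i x < eps i w" "phi1 j x < eps j w"
      | (i) "x = i + 1" "eps i w = 0" "phi1 j x < eps j w"
      | (j) "x = j + 1" "eps j w = 0" "phi1 i x < eps i w"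
      using 1 Cons by (cases "i = j") (auto simp: letter_defs nb_def split: if_splits)
    then show ?thesis
    proof cases
      case both
      then have "in_axiom i j w" by (intro IH) auto
      then show ?thesis using in_axiom_both[OF 1(2)] both Cons by blast
    next
      case i
      have "in_axiom i j (eop j w)" if "0 < eps i (eop j w)" "0 < eps j (eop j w)"
        using that by (intro IH) auto
      then have "in_axiom i j (x # w)" by (rule in_axiom_mixed[OF 1(2) _ i])
      then show ?thesis using Cons by simp
    next
      case j
      have "in_axiom j i (eop i w)" if "0 < eps j (eop i w)" "0 < eps i (eop i w)"
        using that by (intro in_axiom_sym[OF IH]) auto
      then have "in_axiom j i (x # w)" by (rule in_axiom_mixed[OF nb_sym[OF 1(2)] _ j])
      then show ?thesis using Cons in_axiom_sym by simp
    qed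
  qed (use 1 in auto)
qed

text \<open>Reversal together with negation of letters exchanges raising and lowering. The pair
  \<open>i\<close>, \<open>i + 1\<close> becomes \<open>- 1 - i\<close>, \<open>- i\<close>, so
  colour \<open>i\<close> turns into \<open>- 1 - i\<close>. This derives the outgoing axioms from
  the incoming ones.\<close>

definition dual :: "int list \<Rightarrow> int list" where "dual w = rev (map uminus w)"

lemma dual_simps: "dual [] = []" "dual (x # w) = dual w @ [- x]"
  by (auto simp: dual_def)

lemma dual_dual [simp]: "dual (dual w) = w"
  by (simp add: dual_def rev_map comp_def)

lemma eps_phi_dual: "eps (- 1 - i) (dual w) = phi i w \<and> phi (- 1 - i) (dual w) = eps i w"
  by (induction w) (auto simp: dual_simps eps_append phi_append letter_defs)

lemmas eps_dual = eps_phi_dual[THEN conjunct1] and phi_dual = eps_phi_dual[THEN conjunct2]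

lemma eop_dual: "eop (- 1 - i) (dual w) = dual (fop i w)"
  by (induction w) (auto simp: dual_simps eop_append eps_dual phi_dual eop_undefined letter_defs)

lemma nb_dual: "nb (- 1 - i) (- 1 - j) \<longleftrightarrow> nb i j"
  unfolding nb_def by linarith

lemma dual_eq: "dual u = dual w \<longleftrightarrow> u = w"
  by (metis dual_dual)

definition out_axiom :: "int \<Rightarrow> int \<Rightarrow> int list \<Rightarrow> bool" where
  "out_axiom i j v \<longleftrightarrow> \<not> (phi j (fop i v) = phi j v \<and> phi i (fop j v) = phi i v) \<and>
    ((phi j (fop i v) = phi j v \<or> phi i (fop j v) = phi i v) \<longrightarrow> fop i (fop j v) = fop j (fop i v)) \<and>
    (phi j (fop i v) = Suc (phi j v) \<and> phi i (fop j v) = Suc (phi i v) \<longrightarrow>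
      fop i (fop j (fop j (fop i v))) = fop j (fop i (fop i (fop j v))))"

lemma out_axiom:
  assumes "nb i j" "0 < phi i v" "0 < phi j v" shows "out_axiom i j v"
proof -
  have "in_axiom (- 1 - i) (- 1 - j) (dual v)"
    using assms by (intro in_axiom) (simp_all only: nb_dual eps_dual)
  then show ?thesis unfolding in_axiom_def out_axiom_def eop_dual eps_dual dual_eq .
qed

lemma out_axiom_remote_le:
  assumes "nb i j" "0 < phi i w" "0 < phi j w"
    and "phi j (fop i w) = Suc (phi j w)" "phi i (fop j w) = Suc (phi i w)"
  shows "phi i w \<le> phi i (fop j (fop j (fop i w)))"
proof -
  have "nb (- 1 - i) (- 1 - j)" "0 < eps (- 1 - i) (dual w)" "0 < eps (- 1 - j) (dual w)"
    using assms unfolding nb_dual eps_dual by auto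
  from in_axiom_remote_le[OF this in_axiom[OF this]] show ?thesis
    using assms unfolding eps_dual eop_dual by blast
qed

lemma phi_fop_nb:
  assumes "nb i j" "0 < phi i w" shows "phi j (fop i w) = phi j w \<or> phi j (fop i w) = Suc (phi j w)"
  using eps_eop_nb[of "-1-i" "-1-j" "dual w"] assms unfolding nb_dual eps_dual eop_dual by blast

lemma phi_fop_convex:
  assumes "nb i j" "2 \<le> phi i w"
  shows "2 * phi j (fop i w) \<le> phi j w + phi j (fop i (fop i w))"
  using eps_eop_convex[of "-1-i" "-1-j" "dual w"] assms unfolding nb_dual eps_dual eop_dual by blast

lemma far_crystal:
  assumes "i \<noteq> j" "\<not> nb i j"
  shows eps_eop_far: "eps j (eop i w) = eps j w" and eps_fop_far: "eps j (fop i w) = eps j w"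
    and phi_eop_far: "phi j (eop i w) = phi j w" and phi_fop_far: "phi j (fop i w) = phi j w"
proof -
  show e: "eps j (eop i w) = eps j w" "eps j (fop i w) = eps j w" for w
    using assms by (induction w) (auto simp: letter_defs nb_def)
  show "phi j (eop i w) = phi j w" "phi j (fop i w) = phi j w"
    using assms by (induction w) (auto simp: letter_defs nb_def e)
qed

lemma
  assumes "i \<noteq> j" "\<not> nb i j"
  shows eop_eop_far: "eop i (eop j w) = eop j (eop i w)"
    and eop_fop_far: "eop i (fop j w) = fop j (eop i w)"
    and fop_fop_far: "fop i (fop j w) = fop j (fop i w)"
proof -
  have n: "j \<noteq> i" "\<not> nb j i" "j \<noteq> i + 1" "i \<noteq> j + 1" using assms nb_def by auto
  note f = far_crystal[OF assms] far_crystal[OF n(1,2)]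
  show "eop i (eop j w) = eop j (eop i w)"
  proof (induction w)
    case (Cons x w)
    then show ?case using assms(1) n by (cases "x = i + 1"; cases "x = j + 1") (simp_all add: letter_defs f)
  qed simp
  show "eop i (fop j w) = fop j (eop i w)"
  proof (induction w)
    case (Cons x w)
    then show ?case using assms(1) n by (cases "x = i + 1"; cases "x = j") (simp_all add: letter_defs f)
  qed simp
  show "fop i (fop j w) = fop j (fop i w)"
  proof (induction w)
    case (Cons x w)
    then show ?case using assms(1) n by (cases "x = i"; cases "x = j") (simp_all add: letter_defs f)
  qed simp
qed

section \<open>The crystal graph of words\<close>

lemma set_fop: "set (fop i w) \<subseteq> insert (i + 1) (set w)"
  by (induction w) auto

lemma set_eop: "set (eop i w) \<subseteq> insert i (set w)"
  by (induction w) auto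

lemma length_fop [simp]: "length (fop i w) = length w"
  by (induction w) auto

text \<open>The crystal of the \<open>N\<close>-th tensor power of the vector representation, in
  general not connected.\<close>

definition word_graph :: "nat \<Rightarrow> nat \<Rightarrow> int list crystal_graph" where
  "word_graph n N = (let W = {w. set w \<subseteq> {1..int n + 1} \<and> length w = N} in
    \<lparr>verts = W, edges = (\<lambda>i. if i \<in> {1..n} then {(u, fop (int i) u) | u. u \<in> W \<and> 0 < phi (int i) u} else {})\<rparr>)"

lemma verts_word_graph: "verts (word_graph n N) = {w. set w \<subseteq> {1..int n + 1} \<and> length w = N}"
  by (simp add: word_graph_def Let_def)

lemma edge_word_out: "(u, v) \<in> edges (word_graph n N) i \<longleftrightarrow>
    i \<in> {1..n} \<and> u \<in> verts (word_graph n N) \<and> 0 < phi (int i) u \<and> v = fop (int i) u"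
  by (auto simp: word_graph_def Let_def)

lemma fop_word_graph:
  "i \<in> {1..n} \<Longrightarrow> u \<in> verts (word_graph n N) \<Longrightarrow> fop (int i) u \<in> verts (word_graph n N)"
  using set_fop[of "int i" u] by (force simp: verts_word_graph)

lemma eop_word_graph:
  "i \<in> {1..n} \<Longrightarrow> u \<in> verts (word_graph n N) \<Longrightarrow> eop (int i) u \<in> verts (word_graph n N)"
  using set_eop[of "int i" u] by (force simp: verts_word_graph)

lemma edge_word_in: "(u, v) \<in> edges (word_graph n N) i \<longleftrightarrow>
    i \<in> {1..n} \<and> v \<in> verts (word_graph n N) \<and> 0 < eps (int i) v \<and> u = eop (int i) v"
  unfolding edge_word_out using fop_same[of "int i" u] eop_same[of "int i" v] fop_word_graph eop_word_graph
  by auto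

lemma edge_fop: "i \<in> {1..n} \<Longrightarrow> u \<in> verts (word_graph n N) \<Longrightarrow> 0 < phi (int i) u \<Longrightarrow>
    (u, fop (int i) u) \<in> edges (word_graph n N) i"
  by (simp add: edge_word_out)

lemma edge_eop: "i \<in> {1..n} \<Longrightarrow> u \<in> verts (word_graph n N) \<Longrightarrow> 0 < eps (int i) u \<Longrightarrow>
    (u, eop (int i) u) \<in> (edges (word_graph n N) i)\<inverse>"
  by (simp add: edge_word_in)

lemma head_word:
  assumes "u \<in> verts (word_graph n N)" "i \<in> {1..n}"
  shows "head_len (word_graph n N) i u = phi (int i) u"
  unfolding head_len_depth
proof (rule depth_eqI[where C = "verts (word_graph n N)"])
  show "edges (word_graph n N) i \<subseteq> verts (word_graph n N) \<times> verts (word_graph n N)"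
    using fop_word_graph by (auto simp: edge_word_out)
qed (use assms fop_same in \<open>auto simp: edge_word_out Domain_iff\<close>)

lemma tail_word:
  assumes "u \<in> verts (word_graph n N)" "i \<in> {1..n}"
  shows "tail_len (word_graph n N) i u = eps (int i) u"
  unfolding tail_len_depth
proof (rule depth_eqI[where C = "verts (word_graph n N)"])
  show "(edges (word_graph n N) i)\<inverse> \<subseteq> verts (word_graph n N) \<times> verts (word_graph n N)"
    using fop_word_graph by (auto simp: edge_word_out)
qed (use assms eop_same in \<open>auto simp: edge_word_in Domain_iff\<close>)

lemma nb_int: "nb (int i) (int j) \<longleftrightarrow> neighbours i j"
  by (auto simp: nb_def neighbours_def)

lemma A_precrystal_word_graph: "A_precrystal n (word_graph n N)"
proof (unfold_locales, goal_cases)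
  let ?W = "word_graph n N"
  let ?V = "verts ?W"
  {
    case 1
    show ?case unfolding verts_word_graph by (rule finite_lists_length_eq) simp
  next
    case 2
    show ?case using fop_word_graph by (auto simp: edge_word_out)
  next
    case (3 i)
    then show ?case by (auto simp: word_graph_def Let_def)
  next
    case 4
    show ?case by (auto simp: single_valued_def edge_word_out)
  next
    case 5
    show ?case by (auto simp: single_valued_def edge_word_in)
  next
    case (6 i)
    have "edges ?W i \<subseteq> (measure (phi (int i)))\<inverse>"
    proof (intro subrelI)
      fix u v assume "(u, v) \<in> edges ?W i"
      then show "(u, v) \<in> (measure (phi (int i)))\<inverse>"
        using fop_same[of "int i" u] by (simp add: edge_word_out)
    qed
    moreover have "acyclic ((measure (phi (int i)))\<inverse>)"
      using wf_acyclic[OF wf_measure] by simp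
    ultimately show ?case by (rule acyclic_subset[rotated])
  next
    case (7 i j u v)
    have e: "u \<in> ?V" "v \<in> ?V" "0 < phi (int i) u" "v = fop (int i) u" "0 < eps (int i) v" "u = eop (int i) v"
      using 7(4)[unfolded edge_word_out] 7(4)[unfolded edge_word_in] by blast+
    have n: "nb (int i) (int j)" using 7 by (simp add: nb_int)
    have "phi (int j) v = phi (int j) u \<or> phi (int j) v = Suc (phi (int j) u)"
      using phi_fop_nb[OF n e(3)] unfolding e(4)[symmetric] .
    moreover have "word_wt (int j) u = word_wt (int j) v - 1"
      using word_wt_eop_nb[OF n e(5)] unfolding e(6)[symmetric] .
    ultimately show ?case using 7(1,2) e(1,2) by (auto simp: head_word tail_word word_wt_def)
  next
    case (8 i j u v)
    then have e: "u \<in> ?V" "v = fop (int i) u" "v \<in> ?V" using fop_word_graph by (auto simp: edge_word_out)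
    have n: "\<not> nb (int i) (int j)" "int i \<noteq> int j" using 8 by (simp_all add: nb_int)
    show ?case using 8 e n by (simp add: head_word tail_word eps_fop_far phi_fop_far)
  next
    case (9 i j u v w)
    then have e: "u \<in> ?V" "v = fop (int i) u" "v \<in> ?V" "w = fop (int i) v" "w \<in> ?V" "0 < phi (int i) u" "0 < phi (int i) v"
      using fop_word_graph by (auto simp: edge_word_out)
    have n: "nb (int i) (int j)" using 9 by (simp add: nb_int)
    have "2 \<le> phi (int i) u" using e fop_same[of "int i" u] by auto
    then show ?case using phi_fop_convex[OF n] e 9 by (simp add: head_word)
  next
    case (10 i j u v v')
    then have e: "u \<in> ?V" "v = fop (int i) u" "v \<in> ?V" "v' = fop (int j) u" "v' \<in> ?V"
      "0 < phi (int i) u" "0 < phi (int j) u" using fop_word_graph by (auto simp: edge_word_out)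
    have n: "nb (int i) (int j)" "nb (int j) (int i)" using 10 by (auto simp: nb_int neighbours_def)
    have h: "phi (int j) v = phi (int j) u" using 10 e by (simp add: head_word)
    have o: "phi (int i) v' = Suc (phi (int i) u)" "fop (int i) v' = fop (int j) v"
      using out_axiom[OF n(1) e(6,7)] phi_fop_nb[OF n(2) e(7)] h e unfolding out_axiom_def by auto
    have "(u, fop (int j) v) \<in> edges ?W i O edges ?W j"
      by (rule relcompI[of _ v]) (use 10 e h in \<open>auto simp: edge_word_out\<close>)
    moreover have "(u, fop (int j) v) \<in> edges ?W j O edges ?W i"
      by (rule relcompI[of _ v']) (use 10 e o in \<open>auto simp: edge_word_out\<close>)
    ultimately show ?case using o 10 e unfolding commute_at_def by (auto simp: head_word)
  next
    case (11 i j u v u')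
    then have e: "v \<in> ?V" "u = eop (int i) v" "u \<in> ?V" "u' = eop (int j) v" "u' \<in> ?V"
      "0 < eps (int i) v" "0 < eps (int j) v" using eop_word_graph by (auto simp: edge_word_in)
    have n: "nb (int i) (int j)" "nb (int j) (int i)" using 11 by (auto simp: nb_int neighbours_def)
    \<comment> \<open>The weight change translates the given label, which concerns
      \<open>phi\<close>, into a statement about \<open>eps\<close>.\<close>
    have w: "word_wt (int j) u = word_wt (int j) v - 1" "word_wt (int i) u' = word_wt (int i) v - 1"
      using word_wt_eop_nb[OF n(1) e(6)] word_wt_eop_nb[OF n(2) e(7)] e by auto
    have h: "eps (int j) u = eps (int j) v" using 11 e w by (simp add: head_word word_wt_def)
    have o: "eps (int i) u' = Suc (eps (int i) v)" "eop (int i) u' = eop (int j) u"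
      using in_axiom[OF n(1) e(6,7)] eps_eop_nb[OF n(2) e(7)] h e unfolding in_axiom_def by auto
    have "(v, eop (int j) u) \<in> (edges ?W i)\<inverse> O (edges ?W j)\<inverse>"
      by (rule relcompI[of _ u]) (use 11 e h in \<open>auto simp: edge_word_in\<close>)
    moreover have "(v, eop (int j) u) \<in> (edges ?W j)\<inverse> O (edges ?W i)\<inverse>"
      by (rule relcompI[of _ u']) (use 11 e o in \<open>auto simp: edge_word_in\<close>)
    ultimately show ?case using o 11 e w unfolding commute_at_def by (auto simp: head_word word_wt_def)
  next
    case (12 i j u v v')
    then have e: "u \<in> ?V" "v = fop (int i) u" "v \<in> ?V" "v' = fop (int j) u" "v' \<in> ?V"
      "0 < phi (int i) u" "0 < phi (int j) u" using fop_word_graph by (auto simp: edge_word_out)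
    have n: "nb (int i) (int j)" "nb (int j) (int i)" using 12 by (auto simp: nb_int neighbours_def)
    have h: "phi (int j) v = Suc (phi (int j) u)" "phi (int i) v' = Suc (phi (int i) u)"
      using 12 e by (simp_all add: head_word)
    \<comment> \<open>One side of the octagon from \<open>x\<close>;
      \<open>out_axiom_remote_le\<close> ensures that its final lowering is defined.\<close>
    have path: "(x, fop (int l) (fop (int m) (fop (int m) (fop (int l) x))))
        \<in> edges ?W l O edges ?W m O edges ?W m O edges ?W l"
      if x: "x \<in> ?V" "l \<in> {1..n}" "m \<in> {1..n}" "nb (int l) (int m)" "0 < phi (int l) x" "0 < phi (int m) x"
        "phi (int m) (fop (int l) x) = Suc (phi (int m) x)" "phi (int l) (fop (int m) x) = Suc (phi (int l) x)"
      for x l m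
    proof -
      have "phi (int m) (fop (int m) (fop (int l) x)) = phi (int m) x"
        using fop_same[of "int m" "fop (int l) x"] x(7) by simp
      moreover have "phi (int l) x \<le> phi (int l) (fop (int m) (fop (int m) (fop (int l) x)))"
        by (rule out_axiom_remote_le[OF x(4-8)])
      ultimately show ?thesis
        using x by (intro relcompI[of x "fop (int l) x"] relcompI[of "fop (int l) x" "fop (int m) (fop (int l) x)"]
          relcompI[of "fop (int m) (fop (int l) x)" "fop (int m) (fop (int m) (fop (int l) x))"] edge_fop fop_word_graph) auto
    qed
    have "fop (int i) (fop (int j) (fop (int j) (fop (int i) u))) = fop (int j) (fop (int i) (fop (int i) (fop (int j) u)))"
      using out_axiom[OF n(1) e(6,7)] h e unfolding out_axiom_def by auto
    then show ?case unfolding remotely_commute_at_def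
      using path[of u i j] path[of u j i] 12(1,2) e n h by metis
  next
    case (13 i j u v u')
    then have e: "v \<in> ?V" "u = eop (int i) v" "u \<in> ?V" "u' = eop (int j) v" "u' \<in> ?V"
      "0 < eps (int i) v" "0 < eps (int j) v" using eop_word_graph by (auto simp: edge_word_in)
    have n: "nb (int i) (int j)" "nb (int j) (int i)" using 13 by (auto simp: nb_int neighbours_def)
    have w: "word_wt (int j) u = word_wt (int j) v - 1" "word_wt (int i) u' = word_wt (int i) v - 1"
      using word_wt_eop_nb[OF n(1) e(6)] word_wt_eop_nb[OF n(2) e(7)] e by auto
    have h: "eps (int j) u = Suc (eps (int j) v)" "eps (int i) u' = Suc (eps (int i) v)"
      using 13 e w by (simp_all add: head_word word_wt_def)
    have path: "(x, eop (int l) (eop (int m) (eop (int m) (eop (int l) x))))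
        \<in> (edges ?W l)\<inverse> O (edges ?W m)\<inverse> O (edges ?W m)\<inverse> O (edges ?W l)\<inverse>"
      if x: "x \<in> ?V" "l \<in> {1..n}" "m \<in> {1..n}" "nb (int l) (int m)" "0 < eps (int l) x" "0 < eps (int m) x"
        "eps (int m) (eop (int l) x) = Suc (eps (int m) x)" "eps (int l) (eop (int m) x) = Suc (eps (int l) x)"
      for x l m
    proof -
      have "eps (int m) (eop (int m) (eop (int l) x)) = eps (int m) x"
        using eop_same[of "int m" "eop (int l) x"] x(7) by simp
      moreover have "eps (int l) x \<le> eps (int l) (eop (int m) (eop (int m) (eop (int l) x)))"
        by (rule in_axiom_remote_le[OF x(4-6) in_axiom[OF x(4-6)] x(7,8)])
      ultimately show ?thesis
        using x by (intro relcompI[of x "eop (int l) x"] relcompI[of "eop (int l) x" "eop (int m) (eop (int l) x)"]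
          relcompI[of "eop (int m) (eop (int l) x)" "eop (int m) (eop (int m) (eop (int l) x))"] edge_eop eop_word_graph) auto
    qed
    have "eop (int i) (eop (int j) (eop (int j) (eop (int i) v))) = eop (int j) (eop (int i) (eop (int i) (eop (int j) v)))"
      using in_axiom[OF n(1) e(6,7)] h e unfolding in_axiom_def by auto
    then show ?case unfolding remotely_commute_at_def
      using path[of v i j] path[of v j i] 13(1,2) e n h by metis
  next
    case (14 i j P Q u)
    have n: "\<not> nb (int i) (int j)" "int i \<noteq> int j" "\<not> nb (int j) (int i)" "int j \<noteq> int i"
      using 14 by (auto simp: nb_int neighbours_def)
    \<comment> \<open>A Boolean selects forward or backward edges, so that the four combinations of
      directions are treated at once.\<close>
    define p where "p i b = (if b then fop (int i) else eop (int i))" for i b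
    define h where "h i b = (if b then phi (int i) else eps (int i))" for i b
    define R where "R i b = (if b then edges ?W i else (edges ?W i)\<inverse>)" for i b
    have R: "(x, y) \<in> R i b \<longleftrightarrow> i \<in> {1..n} \<and> x \<in> ?V \<and> 0 < h i b x \<and> y = p i b x" for i b x y
      unfolding R_def h_def p_def using edge_word_out edge_word_in by auto
    obtain b c where bc: "P = R i b" "Q = R j c" using 14(5,6) unfolding R_def
      by (metis insert_iff singletonD)
    have V: "p i b x \<in> ?V" if "x \<in> ?V" "i \<in> {1..n}" for i b x
      using that by (simp add: p_def fop_word_graph eop_word_graph)
    have c: "p i b (p j c x) = p j c (p i b x)" for x
      using fop_fop_far[OF n(2,1)] eop_fop_far[OF n(2,1)] eop_fop_far[OF n(4,3)] eop_eop_far[OF n(2,1)] by (simp add: p_def)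
    have hh: "h i b (p j c x) = h i b x" "h j c (p i b x) = h j c x" for x
      using far_crystal[OF n(2,1)] far_crystal[OF n(4,3)] by (simp_all add: p_def h_def)
    have u: "u \<in> ?V" "0 < h i b u" "0 < h j c u" using 14(7,8) unfolding bc by (auto simp: R)
    have "(u, p j c (p i b u)) \<in> R i b O R j c" "(u, p j c (p i b u)) \<in> R j c O R i b"
      using 14(1,2) u V by (auto simp: R hh c intro!: relcompI)
    then show ?case unfolding commute_at_def bc by blast
  }
qed

section \<open>Principal vertices in crystals of words\<close>

text \<open>Colours are applied from right to left, matching the convention of
  \<open>op_prod\<close>.\<close>

fun path :: "('v, 'm) crystal_graph_scheme \<Rightarrow> nat list \<Rightarrow> 'v \<Rightarrow> 'v \<Rightarrow> bool" where
  "path K [] u v \<longleftrightarrow> u = v"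
| "path K (i # ws) u v \<longleftrightarrow> (\<exists>y. path K ws u y \<and> (y, v) \<in> edges K i)"

lemma path_append: "path K (ws @ vs) u v \<longleftrightarrow> (\<exists>y. path K vs u y \<and> path K ws y v)"
  by (induction ws arbitrary: v) auto

lemma op_prod_append: "op_prod (fs @ gs) = op_prod fs \<circ>\<^sub>m op_prod gs"
proof (induction fs)
  case (Cons f fs)
  then show ?case by (auto simp: op_prod_def map_comp_def fun_eq_iff split: option.split)
qed (auto simp: op_prod_def map_comp_def fun_eq_iff split: option.split)

lemma op_prod_Cons: "op_prod (f # fs) = f \<circ>\<^sub>m op_prod fs"
  by (simp add: op_prod_def)

lemma op_prod_concat: "op_prod (concat fss) = op_prod (map op_prod fss)"
  by (induction fss) (simp_all add: op_prod_append op_prod_Cons)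

definition S_word :: "nat \<Rightarrow> nat \<Rightarrow> nat list" where
  "S_word n k = concat (map (\<lambda>j. [j..<j + k]) (rev [1..<n - k + 2]))"

definition principal_word :: "nat \<Rightarrow> (nat \<Rightarrow> nat) \<Rightarrow> nat list" where
  "principal_word n a = concat (map (\<lambda>k. concat (replicate (a k) (S_word n k))) (rev [1..<Suc n]))"

lemma S_op_word: "S_op n K k = op_prod (map (lowering K) (S_word n k))"
  by (simp add: S_op_def S_word_def map_concat op_prod_concat w_op_def[abs_def] comp_def del: upt_Suc)

lemma principal_vertex_word:
  "principal_vertex n K a = op_prod (map (lowering K) (principal_word n (\<lambda>k. nat (a k)))) (source K)"
  by (simp add: principal_vertex_def principal_word_def map_concat op_prod_concat S_op_word comp_def del: upt_Suc)

context A_precrystal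
begin

lemma lowering_iff: "lowering K i u = Some v \<longleftrightarrow> (u, v) \<in> edges K i"
proof
  assume "(u, v) \<in> edges K i"
  then show "lowering K i u = Some v"
    using edge_unique by (auto simp: lowering_def intro!: the_equality)
next
  assume "lowering K i u = Some v"
  then have "\<exists>w. (u, w) \<in> edges K i" "v = (THE v. (u, v) \<in> edges K i)"
    by (auto simp: lowering_def split: if_splits)
  then show "(u, v) \<in> edges K i" using edge_unique theI[of "\<lambda>v. (u, v) \<in> edges K i"] by metis
qed

lemma op_prod_path: "op_prod (map (lowering K) ws) u = Some v \<longleftrightarrow> path K ws u v"
proof (induction ws arbitrary: v)
  case (Cons i ws)
  have "op_prod (map (lowering K) (i # ws)) u = Some v \<longleftrightarrow>
      (\<exists>y. op_prod (map (lowering K) ws) u = Some y \<and> lowering K i y = Some v)"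
    by (auto simp: op_prod_def map_comp_Some_iff)
  then show ?case by (simp add: Cons lowering_iff)
qed (auto simp: op_prod_def)

lemma path_unique: "path K ws u v \<Longrightarrow> path K ws u w \<Longrightarrow> v = w"
  by (metis op_prod_path option.inject)

lemma principal_vertex_path:
  "principal_vertex n' K a = Some x \<longleftrightarrow> path K (principal_word n' (\<lambda>k. nat (a k))) (source K) x"
  by (simp add: principal_vertex_word op_prod_path)

end

section \<open>Column words and their lowering paths\<close>

lemma eps_phi_interval:
  "eps i [l..h] = (if l \<le> h \<and> i + 1 = l then 1 else 0) \<and> phi i [l..h] = (if l \<le> h \<and> i = h then 1 else 0)"
proof (induction "nat (h - l + 1)" arbitrary: l)
  case 0
  then show ?case by auto
next
  case (Suc m)
  then have "l \<le> h" "m = nat (h - (l + 1) + 1)" by auto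
  then show ?case using Suc(1)[of "l + 1"] by (auto simp: upto_rec1 letter_defs)
qed

lemmas eps_interval = eps_phi_interval[THEN conjunct1] and phi_interval = eps_phi_interval[THEN conjunct2]

text \<open>The column is the interval \<open>l..h\<close> with the letter \<open>m\<close> missing;
  lowering by colour \<open>m - 1\<close> moves the gap down to \<open>m - 1\<close>.\<close>

lemma fop_column:
  assumes "l < m" "m \<le> h"
  shows "fop (m - 1) ([l..m - 1] @ [m + 1..h]) = [l..m - 2] @ [m..h]"
    and "0 < phi (m - 1) ([l..m - 1] @ [m + 1..h])"
proof -
  have s: "[l..m - 1] = [l..m - 2] @ [m - 1]" using assms upto_rec2[of l "m - 1"] by simp
  have t: "[m..h] = m # [m + 1..h]" using assms upto_rec1[of m h] by simp
  show "0 < phi (m - 1) ([l..m - 1] @ [m + 1..h])"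
    using assms by (simp add: phi_append phi_interval eps_interval)
  have "fop (m - 1) ([l..m - 1] @ [m + 1..h]) = fop (m - 1) [l..m - 1] @ [m + 1..h]"
    using assms by (simp add: fop_append phi_interval eps_interval)
  also have "fop (m - 1) [l..m - 1] = [l..m - 2] @ [m]"
    unfolding s using assms by (simp add: fop_append phi_interval eps_interval letter_defs)
  finally show "fop (m - 1) ([l..m - 1] @ [m + 1..h]) = [l..m - 2] @ [m..h]" using t by simp
qed

definition lowest :: "nat \<Rightarrow> int list \<Rightarrow> bool" where "lowest n w \<longleftrightarrow> (\<forall>i\<in>{1..n}. phi (int i) w = 0)"
definition highest :: "nat \<Rightarrow> int list \<Rightarrow> bool" where "highest n w \<longleftrightarrow> (\<forall>i\<in>{1..n}. eps (int i) w = 0)"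

lemma lowest_append: "lowest n u \<Longrightarrow> lowest n v \<Longrightarrow> lowest n (u @ v)"
  by (simp add: lowest_def phi_append)

lemma highest_append: "highest n u \<Longrightarrow> highest n v \<Longrightarrow> highest n (u @ v)"
  by (simp add: highest_def eps_append)

text \<open>As \<open>X\<close> has no unmatched \<open>i\<close> and \<open>Y\<close> no unmatched
  \<open>i + 1\<close>, the signature rule places the lowering in the middle factor.\<close>

lemma edge_column:
  assumes "lowest n X" "highest n Y" "i \<in> {1..n}" "0 < phi (int i) C" "X @ C @ Y \<in> verts (word_graph n N)"
  shows "(X @ C @ Y, X @ fop (int i) C @ Y) \<in> edges (word_graph n N) i"
  using assms by (auto simp: edge_word_out lowest_def highest_def phi_append fop_append)

lemma path_verts: "A_precrystal n K \<Longrightarrow> path K ws u v \<Longrightarrow> u \<in> verts K \<Longrightarrow> v \<in> verts K"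
proof (induction ws arbitrary: v)
  case (Cons i ws)
  then show ?case using A_precrystal.edges_in_verts[of n K i] by auto
qed simp

lemma path_column:
  assumes XY: "lowest n X" "highest n Y" and "1 \<le> j" "j + k \<le> Suc n"
    and V: "X @ [int j..int (j + k) - 1] @ Y \<in> verts (word_graph n N)"
  shows "path (word_graph n N) [j..<j + k] (X @ [int j..int (j + k) - 1] @ Y) (X @ [int j + 1..int (j + k)] @ Y)"
proof -
  let ?K = "word_graph n N"
  let ?u = "X @ [int j..int (j + k) - 1] @ Y"
  \<comment> \<open>After the colours \<open>j + k - 1\<close> down to \<open>m\<close>, the gap in
    \<open>j..j + k\<close> has moved from \<open>j + k\<close> to \<open>m\<close>.\<close>
  have "path ?K [m..<j + k] ?u (X @ ([int j..int m - 1] @ [int m + 1..int (j + k)]) @ Y)"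
    if "m \<le> j + k" "j \<le> m" for m
    using that
  proof (induction m rule: inc_induct)
    case (step m)
    let ?C = "[int j..int (Suc m) - 1] @ [int (Suc m) + 1..int (j + k)]"
    have p: "path ?K [Suc m..<j + k] ?u (X @ ?C @ Y)" using step by simp
    have f: "fop (int m) ?C = [int j..int m - 1] @ [int m + 1..int (j + k)]" "0 < phi (int m) ?C"
      using fop_column[of "int j" "int (Suc m)" "int (j + k)"] step by (auto simp: algebra_simps)
    have "(X @ ?C @ Y, X @ fop (int m) ?C @ Y) \<in> edges ?K m"
      by (rule edge_column[OF XY _ f(2) path_verts[OF A_precrystal_word_graph p V]])
        (use step assms in auto)
    moreover have "[m..<j + k] = m # [Suc m..<j + k]" using step by (simp add: upt_conv_Cons)
    ultimately show ?case using p unfolding f by auto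
  qed simp
  from this[of j] show ?thesis by simp
qed

text \<open>Each of the \<open>n - k + 1\<close> factors of the operator shifts the column up by
  one.\<close>

lemma path_S:
  assumes XY: "lowest n X" "highest n Y" and k: "1 \<le> k" "k \<le> n"
    and V: "X @ [1..int k] @ Y \<in> verts (word_graph n N)"
  shows "path (word_graph n N) (S_word n k) (X @ [1..int k] @ Y) (X @ [int n - int k + 2..int n + 1] @ Y)"
proof -
  have "path (word_graph n N) (concat (map (\<lambda>j. [j..<j + k]) (rev [1..<Suc m])))
      (X @ [1..int k] @ Y) (X @ [int m + 1..int m + int k] @ Y)" if "m + k \<le> Suc n" for m
    using that
  proof (induction m)
    case (Suc m)
    let ?v = "X @ [int m + 1..int m + int k] @ Y"
    have p: "path (word_graph n N) (concat (map (\<lambda>j. [j..<j + k]) (rev [1..<Suc m]))) (X @ [1..int k] @ Y) ?v"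
      using Suc by simp
    have "path (word_graph n N) [Suc m..<Suc m + k] ?v (X @ [int (Suc m) + 1..int (Suc m) + int k] @ Y)"
      using path_column[OF XY, of "Suc m" k N] path_verts[OF A_precrystal_word_graph p V] Suc(2)
      by (simp add: algebra_simps)
    moreover have "rev [1..<Suc (Suc m)] = Suc m # rev [1..<Suc m]" by simp
    ultimately show ?case using p by (auto simp: path_append)
  qed simp
  from this[of "n - k + 1"] k show ?thesis
    by (simp add: S_word_def algebra_simps of_nat_diff del: upt_Suc)
qed

lemma highest_column: "highest n [1..int k]"
  by (simp add: highest_def eps_interval)

lemma lowest_column: "lowest n [l..int n + 1]"
  by (simp add: lowest_def phi_interval)

lemma lowest_replicate: "lowest n C \<Longrightarrow> lowest n (concat (replicate r C))"
  by (induction r) (simp_all add: lowest_append, simp add: lowest_def)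

lemma highest_replicate: "highest n C \<Longrightarrow> highest n (concat (replicate r C))"
  by (induction r) (simp_all add: highest_append, simp add: highest_def)

lemma path_S_replicate:
  assumes "lowest n X" and k: "1 \<le> k" "k \<le> n"
    and "highest n Y" "X @ concat (replicate r [1..int k]) @ Y \<in> verts (word_graph n N)"
  shows "path (word_graph n N) (concat (replicate r (S_word n k))) (X @ concat (replicate r [1..int k]) @ Y)
     (X @ concat (replicate r [int n - int k + 2..int n + 1]) @ Y)"
  using assms(4,5)
proof (induction r arbitrary: Y)
  case (Suc r)
  let ?C = "[1..int k]" and ?D = "[int n - int k + 2..int n + 1]"
  have c: "concat (replicate (Suc r) x) = concat (replicate r x) @ x" for x :: "int list"
    by (induction r) simp_all
  have p: "path (word_graph n N) (concat (replicate r (S_word n k))) (X @ concat (replicate r ?C) @ ?C @ Y)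
     (X @ concat (replicate r ?D) @ ?C @ Y)"
    using Suc highest_append[OF highest_column] unfolding c by simp
  have "path (word_graph n N) (S_word n k) ((X @ concat (replicate r ?D)) @ ?C @ Y)
     ((X @ concat (replicate r ?D)) @ ?D @ Y)"
    by (rule path_S[OF lowest_append[OF assms(1) lowest_replicate[OF lowest_column]] Suc(2) k])
      (use path_verts[OF A_precrystal_word_graph p] Suc(3)[unfolded c] in simp)
  then show ?case using p unfolding c by (auto simp: path_append)
qed simp

definition source_word :: "nat \<Rightarrow> (nat \<Rightarrow> nat) \<Rightarrow> int list" where
  "source_word m a = concat (map (\<lambda>k. concat (replicate (a k) [1..int k])) [1..<Suc m])"

definition sink_word :: "nat \<Rightarrow> nat \<Rightarrow> (nat \<Rightarrow> nat) \<Rightarrow> int list" where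
  "sink_word n m a = concat (map (\<lambda>k. concat (replicate (a k) [int n - int k + 2..int n + 1])) [1..<Suc m])"

lemma source_word_Suc: "source_word (Suc m) a = source_word m a @ concat (replicate (a (Suc m)) [1..int (Suc m)])"
  by (simp add: source_word_def)

lemma sink_word_Suc: "sink_word n (Suc m) a =
    sink_word n m a @ concat (replicate (a (Suc m)) [int n - int (Suc m) + 2..int n + 1])"
  by (simp add: sink_word_def)

lemma lowest_sink_word: "lowest n (sink_word n m a)"
proof (induction m)
  case (Suc m)
  then show ?case unfolding sink_word_Suc by (intro lowest_append lowest_replicate lowest_column)
qed (simp add: sink_word_def lowest_def)

lemma highest_source_word: "highest n (source_word m a)"
proof (induction m)
  case (Suc m)
  then show ?case unfolding source_word_Suc by (intro highest_append highest_replicate highest_column)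
qed (simp add: source_word_def highest_def)

text \<open>Columns are transformed from left to right: everything left of the active column is
  already lowest and everything right of it is still highest, so no other column interferes.\<close>

lemma path_principal_word:
  assumes "m \<le> n" "highest n Y" "source_word m a @ Y \<in> verts (word_graph n N)"
  shows "path (word_graph n N) (concat (map (\<lambda>k. concat (replicate (a k) (S_word n k))) (rev [1..<Suc m])))
    (source_word m a @ Y) (sink_word n m a @ Y)"
  using assms
proof (induction m arbitrary: Y)
  case (Suc m)
  let ?b = "concat (replicate (a (Suc m)) [1..int (Suc m)])"
  have p: "path (word_graph n N) (concat (map (\<lambda>k. concat (replicate (a k) (S_word n k))) (rev [1..<Suc m])))
    (source_word m a @ ?b @ Y) (sink_word n m a @ ?b @ Y)"
    by (rule Suc.IH[OF _ highest_append[OF highest_replicate[OF highest_column]]])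
      (use Suc.prems in \<open>simp_all add: source_word_Suc\<close>)
  have "path (word_graph n N) (concat (replicate (a (Suc m)) (S_word n (Suc m)))) (sink_word n m a @ ?b @ Y)
     (sink_word n m a @ concat (replicate (a (Suc m)) [int n - int (Suc m) + 2..int n + 1]) @ Y)"
    by (rule path_S_replicate[OF lowest_sink_word])
      (use path_verts[OF A_precrystal_word_graph p] Suc.prems in \<open>simp_all add: source_word_Suc\<close>)
  moreover have "rev [1..<Suc (Suc m)] = Suc m # rev [1..<Suc m]" by simp
  ultimately show ?case using p by (auto simp: path_append source_word_Suc sink_word_Suc)
qed (simp add: source_word_def sink_word_def)

lemma phi_source_word: "i \<in> {1..n} \<Longrightarrow> phi (int i) (source_word m a) = (if i \<le> m then a i else 0)"
proof (induction m)
  case (Suc m)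
  have r: "phi (int i) (concat (replicate r [1..int k])) = (if i = k then r else 0)" for r k
    using Suc.prems highest_replicate[OF highest_column, of n]
    by (induction r) (auto simp: phi_append phi_interval highest_def)
  have "eps (int i) (concat (replicate (a (Suc m)) [1..int (Suc m)])) = 0"
    using Suc.prems highest_replicate[OF highest_column, of n] unfolding highest_def by blast
  then show ?case using Suc r[of "a (Suc m)" "Suc m"]
    by (auto simp: source_word_Suc phi_append le_Suc_eq simp del: of_nat_Suc)
qed (simp add: source_word_def)

lemma eps_sink_word:
  "i \<in> {1..n} \<Longrightarrow> m \<le> n \<Longrightarrow> eps (int i) (sink_word n m a) = (if n + 1 - i \<le> m then a (n + 1 - i) else 0)"
proof (induction m)
  case (Suc m)
  have r: "eps (int i) (concat (replicate r [int n - int k + 2..int n + 1])) = (if n + 1 - i = k then r else 0)"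
    if "1 \<le> k" "k \<le> n" for r k
    using Suc.prems that lowest_column[of n "int n - int k + 2"]
    by (induction r) (auto simp: eps_append eps_interval lowest_def)
  have "phi (int i) (sink_word n m a) = 0"
    using Suc.prems lowest_sink_word by (auto simp: lowest_def)
  moreover have "n + 1 - i \<le> Suc m \<longleftrightarrow> n + 1 - i \<le> m \<or> n + 1 - i = Suc m" by auto
  ultimately show ?case using Suc r[of "Suc m"] by (auto simp: sink_word_Suc eps_append simp del: of_nat_Suc)
qed (auto simp: sink_word_def)

section \<open>Principal vertices in arbitrary crystals\<close>

text \<open>The component of the source word realises \<open>K(a)\<close>. Its principal vertex at
  \<open>a\<close> is the word of fully lowered columns, a sink whose tail lengths are the parameter
  in reversed order.\<close>

lemma crystal_exists:
  fixes a :: "nat \<Rightarrow> nat"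
  shows "\<exists>L :: int list crystal_graph. A_crystal n L \<and> (\<forall>i\<in>{1..n}. parameter L i = a i) \<and>
    (\<exists>t\<in>verts L. path L (principal_word n a) (source L) t \<and>
      (\<forall>i\<in>{1..n}. head_len L i t = 0 \<and> tail_len L i t = a (n + 1 - i)))"
proof -
  let ?s = "source_word n a" and ?t = "sink_word n n a"
  define N where "N = length ?s"
  let ?K = "word_graph n N"
  have "set ?s \<subseteq> {1..int n + 1}" by (auto simp: source_word_def)
  then have sV: "?s \<in> verts ?K" by (simp add: verts_word_graph N_def)
  have "highest n []" by (simp add: highest_def)
  then have p: "path ?K (principal_word n a) ?s ?t"
    using path_principal_word[of n n "[]" a N] sV by (simp add: principal_word_def)
  interpret A_precrystal n ?K by (rule A_precrystal_word_graph)
  interpret subcrystal_at n ?K 1 n ?s by unfold_locales (use sV in auto)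
  interpret S: A_crystal n S using A_crystal_S by simp
  have pS: "u \<in> C \<and> path S ws ?s u" if "path ?K ws ?s u" for ws u
    using that
  proof (induction ws arbitrary: u)
    case Nil
    then show ?case using v0_C by simp
  next
    case (Cons i ws)
    then obtain y where y: "path ?K ws ?s y" "(y, u) \<in> edges ?K i" by auto
    then have "i \<in> {1..n}" using edge_colour by blast
    moreover from this have c: "y \<in> C" "u \<in> C" "path S ws ?s y"
      using Cons.IH[OF y(1)] y(2) closed[of i y u] by auto
    ultimately have "(y, u) \<in> edges S i" using y(2) unfolding edge_S_iff by simp
    with c show ?case unfolding path.simps by blast
  qed
  have hS: "head_len S i u = phi (int i) u" and tS: "tail_len S i u = eps (int i) u"
    if "i \<in> {1..n}" "u \<in> C" for i u
    using that head_S[of u i] tail_S[of u i] head_word[of u n N i] tail_word[of u n N i] C_verts by auto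
  have s: "source S = ?s"
  proof (rule S.source_eqI)
    fix i assume "i \<in> {1..n}"
    then show "tail_len S i ?s = 0"
      using tS[OF _ v0_C] highest_source_word[of n n a] unfolding highest_def by simp
  qed (simp only: verts_S v0_C)
  have t: "?t \<in> C" "path S (principal_word n a) (source S) ?t" using pS[OF p] s by auto
  have "parameter S i = a i" if "i \<in> {1..n}" for i
    using that hS[OF that v0_C] phi_source_word[OF that, of n a] unfolding parameter_def s by simp
  moreover have "head_len S i ?t = 0 \<and> tail_len S i ?t = a (n + 1 - i)" if i: "i \<in> {1..n}" for i
    using hS[OF i t(1)] tS[OF i t(1)] lowest_sink_word[of n n a] eps_sink_word[OF i, of n a] i
    unfolding lowest_def by auto
  ultimately show ?thesis using S.A_crystal_axioms t verts_S by blast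
qed

lemma (in A_precrystal) path_image:
  assumes "path L ws u v" "\<And>i u v. (u, v) \<in> edges L i \<Longrightarrow> (g u, g v) \<in> edges K i"
  shows "path K ws (g u) (g v)"
  using assms(1) by (induction ws arbitrary: v) (auto intro: assms(2))

lemma adjacent_image:
  assumes "(u, v) \<in> (adjacent L lo hi)\<^sup>*" "\<And>i u v. (u, v) \<in> edges L i \<Longrightarrow> (g u, g v) \<in> edges K i"
  shows "(g u, g v) \<in> (adjacent K lo hi)\<^sup>*"
  using assms(1)
proof induction
  case (step y z)
  then have "(g y, g z) \<in> adjacent K lo hi" using assms(2) by (auto simp: adjacent_def)
  with step show ?case by simp
qed simp

context A_crystal
begin

lemma embedding_source:
  assumes "A_crystal n L" "\<And>i. i \<in> {1..n} \<Longrightarrow> parameter L i \<le> parameter K i"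
  obtains g where "g (source L) = source K"
    "\<And>i u v. (u, v) \<in> edges L i \<Longrightarrow> (g u, g v) \<in> edges K i"
    "\<And>u i. u \<in> verts L \<Longrightarrow> i \<in> {1..n} \<Longrightarrow> tail_len K i (g u) = tail_len L i u"
    "\<And>u i. u \<in> verts L \<Longrightarrow> i \<in> {1..n} \<Longrightarrow>
      head_len K i (g u) + parameter L i = head_len L i u + parameter K i"
proof -
  interpret L: A_crystal n L by fact
  interpret embedding n L K "source K"
    by unfold_locales (use source assms in \<open>auto simp: parameter_def\<close>)
  show thesis using embedding that unfolding parameter_def by blast
qed

text \<open>With equal parameters the embedding of the word crystal also preserves head lengths,
  hence sends a sink to a sink, and the sink of \<open>K\<close> is unique.\<close>

lemma tail_sink:
  assumes "t \<in> verts K" "\<And>i. i \<in> {1..n} \<Longrightarrow> head_len K i t = 0" "i \<in> {1..n}"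
  shows "tail_len K i t = parameter K (n + 1 - i)"
proof -
  obtain L :: "int list crystal_graph" and t0 where L: "A_crystal n L"
    "\<forall>i\<in>{1..n}. parameter L i = parameter K i" "t0 \<in> verts L"
    "\<forall>i\<in>{1..n}. head_len L i t0 = 0 \<and> tail_len L i t0 = parameter K (n + 1 - i)"
    "path L (principal_word n (parameter K)) (source L) t0"
    using crystal_exists by blast
  then have "parameter L i \<le> parameter K i" if "i \<in> {1..n}" for i using that by simp
  from embedding_source[OF L(1) this] obtain g where g: "g (source L) = source K"
    "\<And>i u v. (u, v) \<in> edges L i \<Longrightarrow> (g u, g v) \<in> edges K i"
    "\<And>u i. u \<in> verts L \<Longrightarrow> i \<in> {1..n} \<Longrightarrow> tail_len K i (g u) = tail_len L i u"
    "\<And>u i. u \<in> verts L \<Longrightarrow> i \<in> {1..n} \<Longrightarrow>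
      head_len K i (g u) + parameter L i = head_len L i u + parameter K i" by blast
  have "head_len K j (g t0) = 0" if "j \<in> {1..n}" for j using g(4)[OF L(3) that] L that by simp
  moreover have "g t0 \<in> verts K"
    using path_verts[OF A_precrystal_axioms path_image[where g = g, OF L(5) g(2)]] g(1) source by simp
  ultimately have "t = g t0" using sink_unique[OF connected] assms by blast
  then show ?thesis using g(3)[OF L(3) assms(3)] L(4) assms(3) by simp
qed

end

lemma (in subcrystal_at) source_S:
  obtains z where "z \<in> verts K" "(v0, z) \<in> (adjacent K lo hi)\<^sup>*"
    "\<And>i. i \<in> {lo..hi} \<Longrightarrow> tail_len K i z = 0"
    "\<And>i. i \<in> {lo..hi} \<Longrightarrow> head_len K i z = parameter S (Suc i - lo)"
proof -
  interpret S: A_crystal N S by (rule A_crystal_S)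
  have z: "source S \<in> C" using S.source(1) verts_S by simp
  have i: "Suc i - lo \<in> {1..N}" "\<sigma> (Suc i - lo) = i" if "i \<in> {lo..hi}" for i using that range by auto
  show thesis
  proof (rule that)
    show "source S \<in> verts K" "(v0, source S) \<in> (adjacent K lo hi)\<^sup>*"
      using z C_verts by (auto simp: C_def)
  next
    fix j assume "j \<in> {lo..hi}"
    note j = i[OF this]
    show "tail_len K j (source S) = 0" using S.source(2)[OF j(1)] unfolding tail_S[OF z j(1)] j(2) .
    show "head_len K j (source S) = parameter S (Suc j - lo)"
      unfolding parameter_def head_S[OF z j(1)] j(2) ..
  qed
qed

context A_crystal
begin

text \<open>The sink of \<open>K\<close> is also the sink of its subcrystal, so its tail lengths are
  the parameters of both crystals read backwards; comparing them gives the parameter of the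
  subcrystal.\<close>

lemma sink_subcrystal_source:
  assumes t: "t \<in> verts K" "\<And>i. i \<in> {1..n} \<Longrightarrow> head_len K i t = 0"
    and r: "1 \<le> lo" "lo \<le> Suc hi" "hi \<le> n"
  obtains z where "z \<in> verts K" "(t, z) \<in> (adjacent K lo hi)\<^sup>*"
    "\<And>i. i \<in> {lo..hi} \<Longrightarrow> tail_len K i z = 0"
    "\<And>i. i \<in> {lo..hi} \<Longrightarrow> head_len K i z = parameter K (i + n + 1 - (lo + hi))"
proof -
  interpret U: subcrystal_at n K lo hi t by unfold_locales (use t r in auto)
  interpret S: A_crystal U.N U.S by (rule U.A_crystal_S)
  obtain z where z: "z \<in> verts K" "(t, z) \<in> (adjacent K lo hi)\<^sup>*"
    "\<And>i. i \<in> {lo..hi} \<Longrightarrow> tail_len K i z = 0"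
    "\<And>i. i \<in> {lo..hi} \<Longrightarrow> head_len K i z = parameter U.S (Suc i - lo)"
    using U.source_S by blast
  have "parameter U.S (Suc i - lo) = parameter K (i + n + 1 - (lo + hi))" if i: "i \<in> {lo..hi}" for i
  proof -
    \<comment> \<open>Two reversals are composed: \<open>tail_sink\<close> reverses the colours
      \<open>lo..hi\<close> in the subcrystal and \<open>1..n\<close> in \<open>K\<close>.\<close>
    have k: "Suc hi - i \<in> {1..U.N}" "U.\<sigma> (Suc hi - i) = lo + hi - i" "lo + hi - i \<in> {1..n}" using i r by auto
    have "tail_len U.S (Suc hi - i) t = parameter U.S (U.N + 1 - (Suc hi - i))"
      by (rule S.tail_sink) (use t U.verts_S U.v0_C U.head_S U.\<sigma> k in auto)
    moreover have "tail_len U.S (Suc hi - i) t = tail_len K (lo + hi - i) t"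
      using U.tail_S[OF U.v0_C k(1)] k(2) by simp
    moreover have "\<dots> = parameter K (n + 1 - (lo + hi - i))" by (rule tail_sink[OF t k(3)])
    moreover have "U.N + 1 - (Suc hi - i) = Suc i - lo" "n + 1 - (lo + hi - i) = i + n + 1 - (lo + hi)"
      using i r by auto
    ultimately show ?thesis by simp
  qed
  with z that show thesis by simp
qed

text \<open>Since \<open>a\<close> is bounded by the parameter, \<open>K(a)\<close> embeds in
  \<open>K\<close>, and the operator word of the principal vertex leads to the image of the sink
  \<open>t\<close>.\<close>

lemma principal_vertex_image:
  assumes "a \<in> box n (parameter K)" "principal_vertex n K a = Some x"
  obtains L :: "int list crystal_graph" and t g where "A_crystal n L" "t \<in> verts L" "x = g t"
    "\<And>i. i \<in> {1..n} \<Longrightarrow> int (parameter L i) = a i" "\<And>i. i \<in> {1..n} \<Longrightarrow> head_len L i t = 0"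
    "\<And>i u v. (u, v) \<in> edges L i \<Longrightarrow> (g u, g v) \<in> edges K i" "\<And>u. u \<in> verts L \<Longrightarrow> g u \<in> verts K"
    "\<And>u i. u \<in> verts L \<Longrightarrow> i \<in> {1..n} \<Longrightarrow> tail_len K i (g u) = tail_len L i u"
    "\<And>u i. u \<in> verts L \<Longrightarrow> i \<in> {1..n} \<Longrightarrow>
      int (head_len K i (g u)) = int (head_len L i u) + int (parameter K i) - a i"
proof -
  let ?a = "\<lambda>k. nat (a k)"
  obtain L :: "int list crystal_graph" and t where L: "A_crystal n L"
    "\<forall>i\<in>{1..n}. parameter L i = ?a i" "t \<in> verts L"
    "\<forall>i\<in>{1..n}. head_len L i t = 0" "path L (principal_word n ?a) (source L) t"
    using crystal_exists[of n ?a] by blast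
  have a: "0 \<le> a i" "a i \<le> int (parameter K i)" if "i \<in> {1..n}" for i
    using assms(1) that by (auto simp: box_def)
  have le: "parameter L i \<le> parameter K i" if "i \<in> {1..n}" for i using that L a[OF that] by simp
  from embedding_source[OF L(1) le] obtain g where g: "g (source L) = source K"
    "\<And>i u v. (u, v) \<in> edges L i \<Longrightarrow> (g u, g v) \<in> edges K i"
    "\<And>u i. u \<in> verts L \<Longrightarrow> i \<in> {1..n} \<Longrightarrow> tail_len K i (g u) = tail_len L i u"
    "\<And>u i. u \<in> verts L \<Longrightarrow> i \<in> {1..n} \<Longrightarrow>
      head_len K i (g u) + parameter L i = head_len L i u + parameter K i" by blast
  interpret L: A_crystal n L by fact
  have x: "x = g t"
    using path_unique path_image[where g = g, OF L(5) g(2)] g(1) assms(2) unfolding principal_vertex_path by metis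
  have v: "g u \<in> verts K" if "u \<in> verts L" for u
  proof -
    have "(source L, u) \<in> (adjacent L 1 n)\<^sup>*" using L.connected L.source that by blast
    then have "(source K, g u) \<in> (adjacent K 1 n)\<^sup>*"
      using adjacent_image[where g = g, OF _ g(2)] unfolding g(1)[symmetric] by blast
    then show ?thesis
      by induction (use source edges_in_verts in \<open>auto simp: adjacent_def\<close>)
  qed
  have h: "int (head_len K i (g u)) = int (head_len L i u) + int (parameter K i) - a i"
    if "u \<in> verts L" "i \<in> {1..n}" for u i
    using g(4)[OF that] L(2) that(2) a(1)[OF that(2)] by simp
  show thesis
    by (rule that[of L t g]) (use L x g v h a in auto)
qed

lemma principal_vertex_lengths:
  assumes "a \<in> box n (parameter K)" "principal_vertex n K a = Some x"
  shows "x \<in> verts K" and "i \<in> {1..n} \<Longrightarrow> int (tail_len K i x) = a (n + 1 - i)"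
    and "i \<in> {1..n} \<Longrightarrow> int (head_len K i x) = int (parameter K i) - a i"
proof -
  obtain L :: "int list crystal_graph" and t g where L: "A_crystal n L" "t \<in> verts L" "x = g t"
    "\<And>i. i \<in> {1..n} \<Longrightarrow> int (parameter L i) = a i" "\<And>i. i \<in> {1..n} \<Longrightarrow> head_len L i t = 0"
    "\<And>i u v. (u, v) \<in> edges L i \<Longrightarrow> (g u, g v) \<in> edges K i" "\<And>u. u \<in> verts L \<Longrightarrow> g u \<in> verts K"
    "\<And>u i. u \<in> verts L \<Longrightarrow> i \<in> {1..n} \<Longrightarrow> tail_len K i (g u) = tail_len L i u"
    "\<And>u i. u \<in> verts L \<Longrightarrow> i \<in> {1..n} \<Longrightarrow>
      int (head_len K i (g u)) = int (head_len L i u) + int (parameter K i) - a i"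
    by (rule principal_vertex_image[OF assms]) (rule that)
  interpret L: A_crystal n L by fact
  show "x \<in> verts K" using L(2,3,7) by simp
  show "int (head_len K i x) = int (parameter K i) - a i" if "i \<in> {1..n}"
    using L(9)[OF L(2) that] L(5)[OF that] L(3) by simp
  show "int (tail_len K i x) = a (n + 1 - i)" if "i \<in> {1..n}"
  proof -
    have "n + 1 - i \<in> {1..n}" using that by auto
    then show ?thesis using L(8)[OF L(2) that] L.tail_sink[OF L(2,5) that] L(3,4) by simp
  qed
qed

text \<open>The source is found inside \<open>K(a)\<close>, in the subcrystal through its sink, and
  then transported: tails stay, heads grow by the difference of the parameters.\<close>

lemma principal_subcrystal_source:
  assumes "a \<in> box n (parameter K)" "principal_vertex n K a = Some x"
    and r: "1 \<le> lo" "lo \<le> Suc hi" "hi \<le> n"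
  obtains z where "z \<in> verts K" "(x, z) \<in> (adjacent K lo hi)\<^sup>*"
    "\<And>i. i \<in> {lo..hi} \<Longrightarrow> tail_len K i z = 0"
    "\<And>i. i \<in> {lo..hi} \<Longrightarrow> int (head_len K i z) = int (parameter K i) - a i + a (i + n + 1 - (lo + hi))"
proof -
  obtain L :: "int list crystal_graph" and t g where L: "A_crystal n L" "t \<in> verts L" "x = g t"
    "\<And>i. i \<in> {1..n} \<Longrightarrow> int (parameter L i) = a i" "\<And>i. i \<in> {1..n} \<Longrightarrow> head_len L i t = 0"
    "\<And>i u v. (u, v) \<in> edges L i \<Longrightarrow> (g u, g v) \<in> edges K i" "\<And>u. u \<in> verts L \<Longrightarrow> g u \<in> verts K"
    "\<And>u i. u \<in> verts L \<Longrightarrow> i \<in> {1..n} \<Longrightarrow> tail_len K i (g u) = tail_len L i u"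
    "\<And>u i. u \<in> verts L \<Longrightarrow> i \<in> {1..n} \<Longrightarrow>
      int (head_len K i (g u)) = int (head_len L i u) + int (parameter K i) - a i"
    by (rule principal_vertex_image[OF assms(1,2)]) (rule that)
  interpret L: A_crystal n L by fact
  obtain z where z: "z \<in> verts L" "(t, z) \<in> (adjacent L lo hi)\<^sup>*"
    "\<And>i. i \<in> {lo..hi} \<Longrightarrow> tail_len L i z = 0"
    "\<And>i. i \<in> {lo..hi} \<Longrightarrow> head_len L i z = parameter L (i + n + 1 - (lo + hi))"
    using L.sink_subcrystal_source[OF L(2,5) r] by blast
  have i: "i \<in> {1..n}" "i + n + 1 - (lo + hi) \<in> {1..n}" if "i \<in> {lo..hi}" for i using that r by auto
  show thesis
  proof (rule that)
    show "g z \<in> verts K" using L(7) z(1) .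
    show "(x, g z) \<in> (adjacent K lo hi)\<^sup>*" unfolding L(3) by (rule adjacent_image[where g = g, OF z(2) L(6)])
  next
    fix j assume j: "j \<in> {lo..hi}"
    show "tail_len K j (g z) = 0" using L(8)[OF z(1) i(1)[OF j]] z(3)[OF j] by simp
    show "int (head_len K j (g z)) = int (parameter K j) - a j + a (j + n + 1 - (lo + hi))"
      using L(9)[OF z(1) i(1)[OF j]] z(4)[OF j] L(4)[OF i(2)[OF j]] by simp
  qed
qed

end

section \<open>Deviations\<close>

lemma (in A_precrystal) component_source_unique:
  assumes uv: "(u, v) \<in> (adjacent K lo hi)\<^sup>*" "u \<in> verts K"
    and r: "1 \<le> lo" "lo \<le> Suc hi" "hi \<le> n"
    and "\<And>i. i \<in> {lo..hi} \<Longrightarrow> tail_len K i u = 0" "\<And>i. i \<in> {lo..hi} \<Longrightarrow> tail_len K i v = 0"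
  shows "u = v"
proof -
  interpret U: subcrystal_at n K lo hi u by unfold_locales (use uv r in auto)
  interpret S: A_crystal U.N U.S by (rule U.A_crystal_S)
  have "source U.S = w" if w: "w \<in> U.C" "\<And>i. i \<in> {lo..hi} \<Longrightarrow> tail_len K i w = 0" for w
  proof (rule S.source_eqI)
    show "w \<in> verts U.S" using w U.verts_S by simp
    show "tail_len U.S i w = 0" if "i \<in> {1..U.N}" for i
      unfolding U.tail_S[OF w(1) that] by (rule w(2)[OF U.\<sigma>(2)[OF that]])
  qed
  moreover have "v \<in> U.C" using uv by (simp add: U.C_def)
  ultimately show ?thesis using U.v0_C assms(6,7) by metis
qed

text \<open>The last assumption makes \<open>f\<close> orthogonal to the simple roots of the colours
  \<open>lo..hi\<close>.\<close>

lemma (in A_precrystal) sum_wt_invariant: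
  assumes "(u, v) \<in> (adjacent K lo hi)\<^sup>*" "f 0 = (0::int)" "f (Suc n) = 0"
    and "\<And>i. i \<in> {lo..hi} \<Longrightarrow> 2 * f i = f (i - 1) + f (Suc i)"
  shows "(\<Sum>j=1..n. f j * wt j v) = (\<Sum>j=1..n. f j * wt j u)"
  using assms(1)
proof induction
  case (step y z)
  then obtain i where "i \<in> {lo..hi}" "(y, z) \<in> edges K i \<or> (z, y) \<in> edges K i"
    by (auto simp: adjacent_def)
  then have "(\<Sum>j=1..n. f j * wt j z) = (\<Sum>j=1..n. f j * wt j y)"
    using sum_wt_step[of y z i f] sum_wt_step[of z y i f] assms(2-4) by auto
  with step show ?case by simp
qed simp

lemma (in subcrystal_at) adjacent_S:
  assumes "(u, v) \<in> (adjacent S l h)\<^sup>*" "1 \<le> l"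
  shows "(u, v) \<in> (adjacent K (\<sigma> l) (\<sigma> h))\<^sup>*"
proof -
  have "adjacent S l h \<subseteq> adjacent K (\<sigma> l) (\<sigma> h)"
  proof (intro subrelI)
    fix x y assume "(x, y) \<in> adjacent S l h"
    then obtain k where k: "k \<in> {l..h}" "(x, y) \<in> edges S k \<or> (y, x) \<in> edges S k"
      by (auto simp: adjacent_def)
    then have "(x, y) \<in> edges K (\<sigma> k) \<or> (y, x) \<in> edges K (\<sigma> k)" unfolding edge_S_iff by blast
    moreover have "\<sigma> k \<in> {\<sigma> l..\<sigma> h}" using k(1) assms(2) by auto
    ultimately show "(x, y) \<in> adjacent K (\<sigma> l) (\<sigma> h)" unfolding adjacent_def by blast
  qed
  then show ?thesis using assms(1) rtrancl_mono by blast
qed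

text \<open>Two descriptions of the unique source of the component are compared. For
  \<open>lo = 1\<close>, \<open>hi = n - 1\<close> the last index is \<open>i + 1\<close>; for
  \<open>lo = 2\<close>, \<open>hi = n\<close> it is \<open>i - 1\<close>.\<close>

lemma (in A_crystal) parameter_principal_subcrystal:
  assumes a: "a \<in> box n (parameter K)" "principal_vertex n K a = Some x"
    and r: "1 \<le> lo" "lo \<le> Suc hi" "hi \<le> n" and i: "i \<in> {lo..hi}"
  shows "int (parameter (subcrystal K lo hi x) (Suc i - lo)) =
      int (parameter K i) - a i + a (i + n + 1 - (lo + hi))"
proof -
  interpret U: subcrystal_at n K lo hi x
    by unfold_locales (use principal_vertex_lengths(1)[OF a] r in auto)
  obtain z where z: "z \<in> verts K" "(x, z) \<in> (adjacent K lo hi)\<^sup>*"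
    "\<And>i. i \<in> {lo..hi} \<Longrightarrow> tail_len K i z = 0"
    "\<And>i. i \<in> {lo..hi} \<Longrightarrow> head_len K i z = parameter U.S (Suc i - lo)"
    using U.source_S by blast
  obtain z' where z': "z' \<in> verts K" "(x, z') \<in> (adjacent K lo hi)\<^sup>*"
    "\<And>i. i \<in> {lo..hi} \<Longrightarrow> tail_len K i z' = 0"
    "\<And>i. i \<in> {lo..hi} \<Longrightarrow> int (head_len K i z') = int (parameter K i) - a i + a (i + n + 1 - (lo + hi))"
    using principal_subcrystal_source[OF a r] by blast
  have "(z, z') \<in> (adjacent K lo hi)\<^sup>*"
    using z(2) z'(2) sym_rtrancl[OF sym_adjacent] by (metis rtrancl_trans symD)
  then have "z = z'" by (rule component_source_unique[OF _ z(1) r z(3) z'(3)])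
  then show ?thesis using z(4)[OF i] z'(4)[OF i] by simp
qed

section \<open>Weighted sums of symmetric vectors\<close>

lemma sum_rev: "(\<Sum>j=1..m. f (m + 1 - j)) = (\<Sum>j=1..(m::nat). (f j :: int))"
  using sum.atLeastAtMost_rev[of f 1 m] by (simp add: add.commute)

lemma sum_weighted_symmetric:
  "(\<Sum>j=1..m. int j * (g j + g (m + 1 - j))) = (int m + 1) * (\<Sum>j=1..m. g j)"
proof -
  have "(\<Sum>j=1..m. int j * g (m + 1 - j)) = (\<Sum>j=1..m. int (m + 1 - j) * g (m + 1 - (m + 1 - j)))"
    using sum_rev[of "\<lambda>j. int j * g (m + 1 - j)" m] by simp
  also have "\<dots> = (\<Sum>j=1..m. (int m + 1 - int j) * g j)"
    by (rule sum.cong) (auto simp: of_nat_diff)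
  finally show ?thesis
    by (simp add: distrib_left sum.distrib sum_distrib_left algebra_simps sum_subtractf)
qed

text \<open>\<open>X\<close> and \<open>V\<close> stand for the weights of a heart and of a lattice
  vertex with deviation \<open>d\<close>. Their first \<open>m\<close> coordinates differ by a
  vector symmetric under reversal; the invariant sum then fixes the last coordinate, and with it the
  other functional.\<close>

lemma sum_weights:
  fixes V X d :: "nat \<Rightarrow> int"
  assumes V: "\<And>j. j \<in> {1..m} \<Longrightarrow> V j = X j - d j - d (m + 1 - j)"
    and inv: "(\<Sum>j=1..Suc m. int j * V j) = (\<Sum>j=1..Suc m. int j * X j)"
  shows "(\<Sum>j=1..Suc m. (int m + 2 - int j) * V j) =
    (\<Sum>j=1..Suc m. (int m + 2 - int j) * X j) - (int m + 2) * (\<Sum>j=1..m. d j)"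
proof -
  let ?D = "\<Sum>j=1..m. d j"
  have a: "(\<Sum>j=1..m. int j * V j) = (\<Sum>j=1..m. int j * X j) - (int m + 1) * ?D"
  proof -
    have "(\<Sum>j=1..m. int j * V j) = (\<Sum>j=1..m. int j * X j - int j * (d j + d (m + 1 - j)))"
      by (rule sum.cong) (auto simp: V algebra_simps)
    then show ?thesis by (simp add: sum_subtractf sum_weighted_symmetric[of d m, simplified])
  qed
  have b: "(\<Sum>j=1..m. V j) = (\<Sum>j=1..m. X j) - 2 * ?D"
  proof -
    have "(\<Sum>j=1..m. V j) = (\<Sum>j=1..m. X j - d j - d (m + 1 - j))"
      by (rule sum.cong) (auto simp: V)
    then show ?thesis using sum_rev[of d m] by (simp add: sum_subtractf)
  qed
  have "(int m + 1) * V (Suc m) = (int m + 1) * (X (Suc m) + ?D)"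
    using inv a by (simp add: algebra_simps)
  then have c: "V (Suc m) = X (Suc m) + ?D" by simp
  have e: "(\<Sum>j=1..Suc m. (int m + 2 - int j) * W j) =
      (int m + 2) * (\<Sum>j=1..m. W j) - (\<Sum>j=1..m. int j * W j) + W (Suc m)" for W
    by (simp add: left_diff_distrib distrib_right sum_subtractf sum.distrib sum_distrib_left)
  show ?thesis unfolding e a b c by (simp add: algebra_simps)
qed

lemma zero_if_constant_and_sum_zero:
  fixes e :: "nat \<Rightarrow> int"
  assumes "\<And>i. i \<in> {2..m} \<Longrightarrow> e i = e (i - 1)" "(\<Sum>j=1..m. e j) = 0" "i \<in> {1..m}"
  shows "e i = 0"
proof -
  have c: "e i = e 1" if "i \<in> {1..m}" for i
    using that
  proof (induction i)
    case (Suc i)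
    then show ?case using assms(1)[of "Suc i"] by (cases "i = 0") auto
  qed simp
  have "(\<Sum>j=1..m. e j) = (\<Sum>j=1..m. e 1)"
    by (rule sum.cong[OF refl]) (rule c)
  then show ?thesis using assms(2,3) c[OF assms(3)] by simp
qed

theorem theorem2:
  fixes K :: "'v crystal_graph" and n :: nat and c :: "nat \<Rightarrow> nat"
    and a b hup hdown delta nabla :: "nat \<Rightarrow> int" and x y v w :: 'v
  assumes "2 \<le> n"
    and "A_crystal n K"
    and "\<forall>i\<in>{1..n}. parameter K i = c i"
    and "a \<in> box n c" and "principal_vertex n K a = Some x"
    and "has_upper_coordinate n (upper_subcrystal n K x) x hup"
    and "has_upper_coordinate n (upper_subcrystal n K x) v (\<lambda>i. hup i + delta i)"
    and "b \<in> box n c" and "principal_vertex n K b = Some y"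
    and "verts (middle_subcrystal n K v) \<subseteq> verts (lower_subcrystal n K y)"
    and "has_lower_coordinate n (lower_subcrystal n K y) y hdown"
    and "w \<in> verts (middle_subcrystal n K v)"
    and "has_lower_coordinate n (lower_subcrystal n K y) w (\<lambda>i. hdown i + nabla i)"
  shows "\<forall>i\<in>{2..n}. nabla i = - delta (i - 1)"
proof -
  obtain m where m: "n = Suc m" "1 \<le> m" using assms(1) by (cases n) auto
  interpret A_crystal n K by fact
  let ?c = "\<lambda>i. int (parameter K i)"
  have a: "a \<in> box n (parameter K)" "principal_vertex n K a = Some x"
    and b: "b \<in> box n (parameter K)" "principal_vertex n K b = Some y"
    using assms(3,4,5,8,9) by (auto simp: box_def)
  note x = principal_vertex_lengths[OF a] and y = principal_vertex_lengths[OF b]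

  interpret U: subcrystal_at n K 1 m x by unfold_locales (use x m in auto)
  interpret UA: A_crystal m U.S using U.A_crystal_S by simp
  interpret D: subcrystal_at n K 2 n y by unfold_locales (use y m in auto)
  interpret DA: A_crystal m D.S using D.A_crystal_S m by simp
  have U: "upper_subcrystal n K x = U.S" and D: "lower_subcrystal n K y = D.S"
    by (simp_all add: upper_subcrystal_def lower_subcrystal_def m)

  have c_U: "int (parameter U.S i) = ?c i - a i + a (Suc i)" if "i \<in> {1..m}" for i
    using parameter_principal_subcrystal[OF a, of 1 m i] that m by simp
  have c_D: "int (parameter D.S i) = ?c (Suc i) - b (Suc i) + b i" if "i \<in> {1..m}" for i
    using parameter_principal_subcrystal[OF b, of 2 n "Suc i"] that m by simp
  have len_U: "head_len U.S i u = head_len K i u" "tail_len U.S i u = tail_len K i u"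
    if "u \<in> U.C" "i \<in> {1..m}" for i u
    using U.head_S[OF that(1), of i] U.tail_S[OF that(1), of i] that(2) by auto
  have len_D: "head_len D.S i u = head_len K (Suc i) u" "tail_len D.S i u = tail_len K (Suc i) u"
    if "u \<in> D.C" "i \<in> {1..m}" for i u
    using D.head_S[OF that(1), of i] D.tail_S[OF that(1), of i] that(2) m by auto

  have n1: "n - 1 = m" using m by simp
  have hup: "hup \<in> box m (parameter U.S)" "principal_vertex m U.S hup = Some x"
    and p: "(\<lambda>i. hup i + delta i) \<in> box m (parameter U.S)"
      "principal_vertex m U.S (\<lambda>i. hup i + delta i) = Some v"
    using assms(6,7) unfolding has_upper_coordinate_def has_coordinate_def U n1 by blast+
  have hdown: "(\<lambda>i. hdown (Suc i)) \<in> box m (parameter D.S)"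
      "principal_vertex m D.S (\<lambda>i. hdown (Suc i)) = Some y"
    and q: "(\<lambda>i. hdown (Suc i) + nabla (Suc i)) \<in> box m (parameter D.S)"
      "principal_vertex m D.S (\<lambda>i. hdown (Suc i) + nabla (Suc i)) = Some w"
    using assms(11,13) unfolding has_lower_coordinate_def has_coordinate_def D n1 by blast+
  note v = UA.principal_vertex_lengths[OF p] and w = DA.principal_vertex_lengths[OF q]
  have vC: "v \<in> U.C" and wC: "w \<in> D.C" using v(1) w(1) U.verts_S D.verts_S by auto

  \<comment> \<open>The tail length of the heart at colour \<open>m + 1 - i\<close> is
    \<open>a (Suc i)\<close> when computed in \<open>K\<close> and \<open>hup i\<close> when
    computed in the subcrystal.\<close>
  have h_U: "hup i = a (Suc i)" if i: "i \<in> {1..m}" for i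
  proof -
    have k: "m + 1 - i \<in> {1..m}" using i by auto
    then show ?thesis
      using UA.principal_vertex_lengths(2)[OF hup k] x(2)[of "m + 1 - i"] len_U(2)[OF U.v0_C k] i m
      by (simp add: Suc_diff_le)
  qed
  have h_D: "hdown (Suc i) = b i" if i: "i \<in> {1..m}" for i
  proof -
    have k: "m + 1 - i \<in> {1..m}" using i by auto
    then show ?thesis
      using DA.principal_vertex_lengths(2)[OF hdown k] y(2)[of "Suc (m + 1 - i)"] len_D(2)[OF D.v0_C k] i m
      by (simp add: Suc_diff_le)
  qed

  \<comment> \<open>Compared with the heart, colour \<open>i\<close> loses \<open>delta i\<close> in
    head length and gains \<open>delta (m + 1 - i)\<close> in tail length; the terms in
    \<open>a\<close> cancel.\<close>
  have wt_v: "wt i v = wt i x - delta i - delta (m + 1 - i)" if i: "i \<in> {1..m}" for i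
  proof -
    have k: "m + 1 - i \<in> {1..m}" "i \<in> {1..n}" using i m by auto
    show ?thesis using v(2,3)[OF i] x(2,3)[OF k(2)] len_U[OF vC i] c_U[OF i] h_U[OF i] h_U[OF k(1)] i m
      by (simp add: wt_def Suc_diff_le)
  qed
  have wt_w: "wt (Suc i) w = wt (Suc i) y - nabla (Suc i) - nabla (Suc (m + 1 - i))" if i: "i \<in> {1..m}" for i
  proof -
    have k: "m + 1 - i \<in> {1..m}" "Suc i \<in> {1..n}" using i m by auto
    show ?thesis using w(2,3)[OF i] y(2,3)[OF k(2)] len_D[OF wC i] c_D[OF i] h_D[OF i] h_D[OF k(1)] i m
      by (simp add: wt_def Suc_diff_le)
  qed

  have vw: "(v, w) \<in> (adjacent K 2 m)\<^sup>*"
    using assms(12) by (simp add: middle_subcrystal_def subcrystal_def Let_def m)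

  \<comment> \<open>At the source of the middle subcrystal the head length of colour
    \<open>i\<close> is \<open>?c i - delta i + delta (i - 1)\<close> through the upper subcrystal
    and \<open>?c i - nabla i + nabla (Suc i)\<close> through the lower one.\<close>
  have "nabla (Suc i) + delta i = nabla i + delta (i - 1)" if i: "i \<in> {2..m}" for i
  proof -
    obtain z where z: "z \<in> verts U.S" "(v, z) \<in> (adjacent U.S 2 m)\<^sup>*"
      "\<And>i. i \<in> {2..m} \<Longrightarrow> tail_len U.S i z = 0"
      "\<And>i. i \<in> {2..m} \<Longrightarrow> int (head_len U.S i z) = int (parameter U.S i) - (hup i + delta i)
         + (hup (i + m + 1 - (2 + m)) + delta (i + m + 1 - (2 + m)))"
      using UA.principal_subcrystal_source[OF p, of 2 m] m by auto
    obtain z' where z': "z' \<in> verts D.S" "(w, z') \<in> (adjacent D.S 1 (m - 1))\<^sup>*"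
      "\<And>i. i \<in> {1..m - 1} \<Longrightarrow> tail_len D.S i z' = 0"
      "\<And>i. i \<in> {1..m - 1} \<Longrightarrow> int (head_len D.S i z') = int (parameter D.S i)
         - (hdown (Suc i) + nabla (Suc i))
         + (hdown (Suc (i + m + 1 - (1 + (m - 1)))) + nabla (Suc (i + m + 1 - (1 + (m - 1)))))"
      using DA.principal_subcrystal_source[OF q, of 1 "m - 1"] m by auto
    have C: "z \<in> U.C" "z' \<in> D.C" using z(1) z'(1) U.verts_S D.verts_S by auto
    have "(v, z) \<in> (adjacent K 2 m)\<^sup>*" using U.adjacent_S[OF z(2)] by (simp add: numeral_2_eq_2)
    moreover have "(w, z') \<in> (adjacent K 2 m)\<^sup>*" using D.adjacent_S[OF z'(2)] m by (simp add: numeral_2_eq_2)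
    ultimately have "(z, z') \<in> (adjacent K 2 m)\<^sup>*"
      using vw sym_rtrancl[OF sym_adjacent] by (metis rtrancl_trans symD)
    then have "z = z'"
    proof (rule component_source_unique)
      show "z \<in> verts K" using C U.C_verts by blast
      show "tail_len K i z = 0" if "i \<in> {2..m}" for i
        using z(3)[OF that] len_U(2)[OF C(1), of i] that by simp
      show "tail_len K i z' = 0" if "i \<in> {2..m}" for i
        using z'(3)[of "i - 1"] len_D(2)[OF C(2), of "i - 1"] that by (cases i) auto
    qed (use m in auto)
    moreover obtain k where k: "i = Suc k" "k \<in> {1..m - 1}" "k \<in> {1..m}" "i \<in> {1..m}"
      using i by (cases i) auto
    ultimately show ?thesis
      using z(4)[OF i] z'(4)[OF k(2)] len_U(1)[OF C(1) k(4)] len_D(1)[OF C(2) k(3)]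
        c_U[OF k(4)] c_D[OF k(3)] h_U[OF k(4)] h_U[OF k(3)] h_D[OF k(3)] h_D[OF k(4)] m
      by (simp add: k(1))
  qed
  moreover have "(\<Sum>j=1..m. nabla (Suc j) + delta j) = 0"
  proof -
    define A where "A u = (\<Sum>j=1..n. int j * wt j u)" for u
    define B where "B u = (\<Sum>j=1..n. (int m + 2 - int j) * wt j u)" for u
    have A: "A u = A u'" if "(u, u') \<in> (adjacent K lo m)\<^sup>*" "1 \<le> lo" for u u' lo
    proof -
      \<comment> \<open>The coefficient is set to 0 at \<open>n + 1\<close> to meet the boundary
        condition; colours up to \<open>m = n - 1\<close> have neighbours at most \<open>n\<close>
        and do not see this. Likewise the coefficients of \<open>B\<close> are cut off at 0.\<close>
      have "(\<Sum>j=1..n. (if j = Suc n then 0 else int j) * wt j u') =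
          (\<Sum>j=1..n. (if j = Suc n then 0 else int j) * wt j u)"
        by (rule sum_wt_invariant[OF that(1)]) (use that(2) m in \<open>auto simp: of_nat_diff\<close>)
      then show ?thesis by (simp add: A_def)
    qed
    have B: "B u = B u'" if "(u, u') \<in> (adjacent K 2 hi)\<^sup>*" "hi \<le> n" for u u' hi
    proof -
      have "(\<Sum>j=1..n. (if j = 0 then 0 else int m + 2 - int j) * wt j u') =
          (\<Sum>j=1..n. (if j = 0 then 0 else int m + 2 - int j) * wt j u)"
        by (rule sum_wt_invariant[OF that(1)]) (use that(2) m in \<open>auto simp: of_nat_diff\<close>)
      then show ?thesis by (simp add: B_def)
    qed
    have "(x, v) \<in> (adjacent K 1 m)\<^sup>*" "(y, w) \<in> (adjacent K 2 n)\<^sup>*"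
      using vC wC unfolding U.C_def D.C_def by blast+
    then have "A x = A v" "B y = B w" using A[of x v 1] B[of y w n] by simp_all
    from \<open>A x = A v\<close> have Bv: "B v = B x - (int m + 2) * (\<Sum>j=1..m. delta j)"
      unfolding A_def B_def m(1) by (intro sum_weights) (simp_all add: wt_v)
    have rev: "(\<Sum>j=1..Suc m. f j) = (\<Sum>j=1..Suc m. f (Suc (m + 1 - j)))" for f :: "nat \<Rightarrow> int"
      using sum_rev[of f "Suc m"] by (simp add: Suc_diff_le)
    \<comment> \<open>Reversing the colours exchanges the two functionals, so
      \<open>sum_weights\<close> serves the lower subcrystal as well.\<close>
    have Ar: "A u = (\<Sum>j=1..Suc m. (int m + 2 - int j) * wt (Suc (m + 1 - j)) u)" for u
      unfolding A_def m(1) by (subst rev, rule sum.cong) (auto simp: of_nat_diff)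
    have Br: "B u = (\<Sum>j=1..Suc m. int j * wt (Suc (m + 1 - j)) u)" for u
      unfolding B_def m(1) by (subst rev, rule sum.cong) (auto simp: of_nat_diff)
    from \<open>B y = B w\<close> have Aw: "A w = A y - (int m + 2) * (\<Sum>j=1..m. nabla (Suc j))"
      unfolding Ar Br
    proof (intro sum_weights)
      fix j assume j: "j \<in> {1..m}"
      then have "m + 1 - j \<in> {1..m}" "m + 1 - (m + 1 - j) = j" by auto
      then show "wt (Suc (m + 1 - j)) w = wt (Suc (m + 1 - j)) y - nabla (Suc j) - nabla (Suc (m + 1 - j))"
        using wt_w[of "m + 1 - j"] by simp
    qed simp
    \<comment> \<open>The weight of a heart is \<open>?c\<close> minus a vector invariant under
      \<open>j \<mapsto> n + 1 - j\<close>. On such a vector \<open>A\<close> and \<open>B\<close>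
      agree, so \<open>A - B\<close> takes the same value at both hearts.\<close>
    have AB: "A u - B u = (\<Sum>j=1..n. int j * ?c j) - (\<Sum>j=1..n. (int m + 2 - int j) * ?c j)"
      if "\<And>j. j \<in> {1..n} \<Longrightarrow> wt j u = ?c j - (e j + e (n + 1 - j))" for u e
    proof -
      let ?s = "\<lambda>j. e j + e (n + 1 - j)"
      have "A u = (\<Sum>j=1..n. int j * ?c j - int j * ?s j)"
        unfolding A_def by (rule sum.cong) (auto simp: that algebra_simps)
      moreover have "B u = (\<Sum>j=1..n. (int m + 2 - int j) * ?c j - (int m + 2 - int j) * ?s j)"
        unfolding B_def by (rule sum.cong) (auto simp: that algebra_simps)
      moreover have "(\<Sum>j=1..n. int j * ?s j) = (\<Sum>j=1..n. (int m + 2 - int j) * ?s j)"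
        unfolding m(1) by (subst rev, rule sum.cong) (auto simp: of_nat_diff Suc_diff_le add.commute)
      ultimately show ?thesis by (simp add: sum_subtractf)
    qed
    have "A x - B x = A y - B y"
      using AB[of x a] AB[of y b] x(2,3) y(2,3) by (simp add: wt_def)
    \<comment> \<open>The colours of a middle subcrystal leave both functionals constant. Passing
      from \<open>x\<close> through \<open>v\<close> and \<open>w\<close> to \<open>y\<close> then
      leaves only the two sums of deviations.\<close>
    moreover have "A v = A w" "B v = B w" using A[OF vw] B[OF vw] m by auto
    ultimately have "(int m + 2) * ((\<Sum>j=1..m. nabla (Suc j)) + (\<Sum>j=1..m. delta j)) = 0"
      using Bv Aw \<open>A x = A v\<close> \<open>B y = B w\<close> by (simp add: algebra_simps)
    then show ?thesis by (simp add: sum.distrib)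
  qed
  ultimately have zero: "nabla (Suc i) + delta i = 0" if "i \<in> {1..m}" for i
    using zero_if_constant_and_sum_zero[of m "\<lambda>i. nabla (Suc i) + delta i" i] that by simp
  show ?thesis
  proof
    fix i assume "i \<in> {2..n}"
    then obtain k where "i = Suc k" "k \<in> {1..m}" using m by (cases i) auto
    then show "nabla i = - delta (i - 1)" using zero[of k] by simp
  qed
qed

end
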